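(* Let $\mathbb{F}_\theta^+$ be a 2-graph on a single vertex with graph C*-algebra $\mathcal{O}_\theta$. Under the multiplication $$(U_2,V_2)\cdot(U_1,V_1):=\big(\lambda_{(U_2,V_2)}(U_1)U_2,\ \lambda_{(U_2,V_2)}(V_1)V_2\big)\qquad\big((U_1,V_1),(U_2,V_2)\in\mathcal{U}(\mathcal{O}_\theta)^2_{\rm twi}\big),$$ the set $\mathcal{U}(\mathcal{O}_\theta)^2_{\rm twi}$ is a unital semigroup, and the bijection $\Psi:\mathcal{U}(\mathcal{O}_\theta)^2_{\rm twi}\to\mathrm{End}(\mathcal{O}_\theta)$, $(U,V)\mapsto\lambda_{(U,V)}$, is a unital semigroup isomorphism (where $\mathrm{End}(\mathcal{O}_\theta)$ carries composition).
   Context: Let $\theta$ be a permutation of $\{1,\dots,m\}\times\{1,\dots,n\}$. The 2-graph on a single vertex $\mathbb{F}_\theta^+$ is the unital semigroup (identity $\varnothing$) generated by $e_1,\dots,e_m,f_1,\dots,f_n$, free in the $e_i$'s and free in the $f_j$'s, with the commutation relations $e_if_j=f_{j'}e_{i'}$ whenever $\theta(i,j)=(i',j')$. $\mathcal{O}_\theta$ is the universal C*-algebra generated by isometries $\{s_u:u\in\mathbb{F}_\theta^+\}$ with $s_\varnothing=I$, $s_{uv}=s_us_v$, and $\sum_{i=1}^m s_{e_i}s_{e_i}^*=I=\sum_{j=1}^n s_{f_j}s_{f_j}^*$. $\mathrm{End}(\mathcal{O}_\theta)$ is the semigroup of unital endomorphisms of $\mathcal{O}_\theta$, and $\mathcal{U}(\mathcal{O}_\theta)$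 is the set of unitaries. Put $\lambda_{\epsilon_1}(X)=\sum_{i=1}^m s_{e_i}Xs_{e_i}^*$ and $\lambda_{\epsilon_2}(X)=\sum_{j=1}^n s_{f_j}Xs_{f_j}^*$, and $$\mathcal{U}(\mathcal{O}_\theta)^2_{\rm twi}=\{(U,V)\in\mathcal{U}(\mathcal{O}_\theta)\times\mathcal{U}(\mathcal{O}_\theta):\ U\lambda_{\epsilon_1}(V)=V\lambda_{\epsilon_2}(U)\}.$$ For $(U,V)\in\mathcal{U}(\mathcal{O}_\theta)^2_{\rm twi}$, $\lambda_{(U,V)}$ denotes the unique unital endomorphism of $\mathcal{O}_\theta$ with $\lambda_{(U,V)}(s_{e_i})=Us_{e_i}$ and $\lambda_{(U,V)}(s_{f_j})=Vs_{f_j}$ for all $i,j$; the map $(U,V)\mapsto\lambda_{(U,V)}$ is a bijection of $\mathcal{U}(\mathcal{O}_\theta)^2_{\rm twi}$ onto $\mathrm{End}(\mathcal{O}_\theta)$. *)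

theory Defs
  imports
    "HOL-Analysis.Analysis"
    "HOL-Combinatorics.Permutations"
    "HOL-Algebra.Module"
begin

section \<open>Unital C*-algebras\<close>

definition complex_ring :: "complex ring" where
  "complex_ring = \<lparr>carrier = UNIV, monoid.mult = (*), one = 1, zero = 0, add = (+)\<rparr>"

record 'a cstar = "(complex, 'a) module" +
  star :: "'a \<Rightarrow> 'a" (\<open>(_\<^sup>\<star>\<index>)\<close> [1000] 999)
  cnorm :: "'a \<Rightarrow> real"

locale unital_cstar_algebra = ring A + module complex_ring A for A :: "'a cstar" (structure) +
  assumes smult_mult_left:
      "\<lbrakk>x \<in> carrier A; y \<in> carrier A\<rbrakk> \<Longrightarrow> (c \<odot> x) \<otimes> y = c \<odot> (x \<otimes> y)"
    and smult_mult_right: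
      "\<lbrakk>x \<in> carrier A; y \<in> carrier A\<rbrakk> \<Longrightarrow> x \<otimes> (c \<odot> y) = c \<odot> (x \<otimes> y)"
    and star_closed: "x \<in> carrier A \<Longrightarrow> x\<^sup>\<star> \<in> carrier A"
    and star_star: "x \<in> carrier A \<Longrightarrow> (x\<^sup>\<star>)\<^sup>\<star> = x"
    and star_add: "\<lbrakk>x \<in> carrier A; y \<in> carrier A\<rbrakk> \<Longrightarrow> (x \<oplus> y)\<^sup>\<star> = x\<^sup>\<star> \<oplus> y\<^sup>\<star>"
    and star_mult: "\<lbrakk>x \<in> carrier A; y \<in> carrier A\<rbrakk> \<Longrightarrow> (x \<otimes> y)\<^sup>\<star> = y\<^sup>\<star> \<otimes> x\<^sup>\<star>"
    and star_smult: "x \<in> carrier A \<Longrightarrow> (c \<odot> x)\<^sup>\<star> = cnj c \<odot> x\<^sup>\<star>"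
    and cnorm_eq_zero: "x \<in> carrier A \<Longrightarrow> cnorm A x = 0 \<longleftrightarrow> x = \<zero>"
    and cnorm_triangle:
      "\<lbrakk>x \<in> carrier A; y \<in> carrier A\<rbrakk> \<Longrightarrow> cnorm A (x \<oplus> y) \<le> cnorm A x + cnorm A y"
    and cnorm_smult: "x \<in> carrier A \<Longrightarrow> cnorm A (c \<odot> x) = cmod c * cnorm A x"
    and cnorm_mult:
      "\<lbrakk>x \<in> carrier A; y \<in> carrier A\<rbrakk> \<Longrightarrow> cnorm A (x \<otimes> y) \<le> cnorm A x * cnorm A y"
    and cstar_identity: "x \<in> carrier A \<Longrightarrow> cnorm A (x\<^sup>\<star> \<otimes> x) = (cnorm A x)\<^sup>2"
    and complete:
      "\<lbrakk>\<And>k. X k \<in> carrier A;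
        \<And>\<epsilon>. \<epsilon> > 0 \<Longrightarrow> \<exists>N. \<forall>j\<ge>N. \<forall>k\<ge>N. cnorm A (X j \<ominus> X k) < \<epsilon>\<rbrakk>
       \<Longrightarrow> \<exists>x\<in>carrier A. (\<lambda>k. cnorm A (X k \<ominus> x)) \<longlonglongrightarrow> 0"

definition cstar_subalgebra :: "'a cstar \<Rightarrow> 'a set \<Rightarrow> bool" where
  "cstar_subalgebra A S \<longleftrightarrow>
     S \<subseteq> carrier A \<and> \<zero>\<^bsub>A\<^esub> \<in> S \<and>
     (\<forall>x\<in>S. \<forall>y\<in>S. x \<oplus>\<^bsub>A\<^esub> y \<in> S \<and> x \<otimes>\<^bsub>A\<^esub> y \<in> S) \<and>
     (\<forall>c. \<forall>x\<in>S. c \<odot>\<^bsub>A\<^esub> x \<in> S) \<and>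
     (\<forall>x\<in>S. x\<^sup>\<star>\<^bsub>A\<^esub> \<in> S) \<and>
     (\<forall>X. \<forall>x\<in>carrier A.
        (\<forall>k. X k \<in> S) \<and> (\<lambda>k. cnorm A (X k \<ominus>\<^bsub>A\<^esub> x)) \<longlonglongrightarrow> 0 \<longrightarrow> x \<in> S)"

definition generates_cstar :: "'a cstar \<Rightarrow> 'a set \<Rightarrow> bool" where
  "generates_cstar A G \<longleftrightarrow> G \<subseteq> carrier A \<and> (\<forall>S. cstar_subalgebra A S \<and> G \<subseteq> S \<longrightarrow> S = carrier A)"

definition unital_star_hom :: "'a cstar \<Rightarrow> 'b cstar \<Rightarrow> ('a \<Rightarrow> 'b) set" where
  "unital_star_hom A B =
     {h \<in> ring_hom A B.
        (\<forall>c. \<forall>x\<in>carrier A. h (c \<odot>\<^bsub>A\<^esub> x) = c \<odot>\<^bsub>B\<^esub> h x) \<and>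
        (\<forall>x\<in>carrier A. h (x\<^sup>\<star>\<^bsub>A\<^esub>) = (h x)\<^sup>\<star>\<^bsub>B\<^esub>)}"

text \<open>Endomorphisms are taken to be extensional (\<open>undefined\<close> off the carrier), so that two of them
  are equal as soon as they agree on the algebra.\<close>

definition End_monoid :: "'a cstar \<Rightarrow> ('a \<Rightarrow> 'a) monoid" where
  "End_monoid A =
     \<lparr>carrier = unital_star_hom A A \<inter> extensional (carrier A),
      monoid.mult = compose (carrier A),
      one = (\<lambda>x\<in>carrier A. x)\<rparr>"

definition unitaries :: "'a cstar \<Rightarrow> 'a set" where
  "unitaries A = {U \<in> carrier A. U\<^sup>\<star>\<^bsub>A\<^esub> \<otimes>\<^bsub>A\<^esub> U = \<one>\<^bsub>A\<^esub> \<and> U \<otimes>\<^bsub>A\<^esub> U\<^sup>\<star>\<^bsub>A\<^esub> = \<one>\<^bsub>A\<^esub>}"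

section \<open>2-graphs on a single vertex\<close>

datatype edge = E nat | F nat

definition words :: "nat \<Rightarrow> nat \<Rightarrow> edge list set" where
  "words m n = lists (E ` {1..m} \<union> F ` {1..n})"

inductive word_cong :: "nat \<Rightarrow> nat \<Rightarrow> (nat \<times> nat \<Rightarrow> nat \<times> nat) \<Rightarrow> edge list \<Rightarrow> edge list \<Rightarrow> bool"
  for m n \<theta> where
  commute: "\<lbrakk>u \<in> words m n; v \<in> words m n; i \<in> {1..m}; j \<in> {1..n}; \<theta> (i, j) = (i', j');
             i' \<in> {1..m}; j' \<in> {1..n}\<rbrakk>
            \<Longrightarrow> word_cong m n \<theta> (u @ [E i, F j] @ v) (u @ [F j', E i'] @ v)"
| refl: "u \<in> words m n \<Longrightarrow> word_cong m n \<theta> u u"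
| sym: "word_cong m n \<theta> u v \<Longrightarrow> word_cong m n \<theta> v u"
| trans: "\<lbrakk>word_cong m n \<theta> u v; word_cong m n \<theta> v w\<rbrakk> \<Longrightarrow> word_cong m n \<theta> u w"

definition word_rel :: "nat \<Rightarrow> nat \<Rightarrow> (nat \<times> nat \<Rightarrow> nat \<times> nat) \<Rightarrow> edge list rel" where
  "word_rel m n \<theta> = {(u, v). word_cong m n \<theta> u v}"

text \<open>The presented monoid: words modulo the congruence generated by \<open>e\<^sub>i f\<^sub>j = f\<^sub>j\<^sub>' e\<^sub>i\<^sub>'\<close>.  The product of two
  classes is a union of coinciding classes, see \<open>F_theta_mult\<close> below.\<close>

definition F_theta :: "nat \<Rightarrow> nat \<Rightarrow> (nat \<times> nat \<Rightarrow> nat \<times> nat) \<Rightarrow> edge list set monoid" where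
  "F_theta m n \<theta> =
     \<lparr>carrier = words m n // word_rel m n \<theta>,
      monoid.mult = (\<lambda>X Y. \<Union>u\<in>X. \<Union>v\<in>Y. word_rel m n \<theta> `` {u @ v}),
      one = word_rel m n \<theta> `` {[]}\<rparr>"

definition edge_e :: "nat \<Rightarrow> nat \<Rightarrow> (nat \<times> nat \<Rightarrow> nat \<times> nat) \<Rightarrow> nat \<Rightarrow> edge list set" where
  "edge_e m n \<theta> i = word_rel m n \<theta> `` {[E i]}"

definition edge_f :: "nat \<Rightarrow> nat \<Rightarrow> (nat \<times> nat \<Rightarrow> nat \<times> nat) \<Rightarrow> nat \<Rightarrow> edge list set" where
  "edge_f m n \<theta> j = word_rel m n \<theta> `` {[F j]}"

lemma word_cong_words: "word_cong m n \<theta> u v \<Longrightarrow> u \<in> words m n \<and> v \<in> words m n"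
  by (induction rule: word_cong.induct) (auto simp: words_def)

lemma equiv_word_rel: "equiv (words m n) (word_rel m n \<theta>)"
  by (rule equivI)
     (auto simp: word_rel_def refl_on_def sym_def trans_def
           dest: word_cong_words intro: word_cong.refl word_cong.sym word_cong.trans)

lemma word_cong_append_left:
  "\<lbrakk>word_cong m n \<theta> u v; w \<in> words m n\<rbrakk> \<Longrightarrow> word_cong m n \<theta> (w @ u) (w @ v)"
proof (induction rule: word_cong.induct)
  case (commute u v i j i' j')
  then show ?case
    using word_cong.commute[of "w @ u" m n v i j \<theta> i' j'] by (simp add: words_def)
next
  case (refl u)
  then show ?case by (intro word_cong.refl) (simp add: words_def)
qed (blast intro: word_cong.sym word_cong.trans)+

lemma word_cong_append_right:
  "\<lbrakk>word_cong m n \<theta> u v; w \<in> words m n\<rbrakk> \<Longrightarrow> word_cong m n \<theta> (u @ w) (v @ w)"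
proof (induction rule: word_cong.induct)
  case (commute u v i j i' j')
  then show ?case
    using word_cong.commute[of u m n "v @ w" i j \<theta> i' j'] by (simp add: words_def)
next
  case (refl u)
  then show ?case by (intro word_cong.refl) (simp add: words_def)
qed (blast intro: word_cong.sym word_cong.trans)+

lemma word_cong_append:
  "\<lbrakk>word_cong m n \<theta> u u'; word_cong m n \<theta> v v'\<rbrakk> \<Longrightarrow> word_cong m n \<theta> (u @ v) (u' @ v')"
  by (meson word_cong.trans word_cong_append_left word_cong_append_right word_cong_words)

lemma F_theta_mult:
  assumes "u \<in> words m n" "v \<in> words m n"
  shows "word_rel m n \<theta> `` {u} \<otimes>\<^bsub>F_theta m n \<theta>\<^esub> word_rel m n \<theta> `` {v} = word_rel m n \<theta> `` {u @ v}"
proof -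
  let ?c = "\<lambda>w. word_rel m n \<theta> `` {w}"
  have eq: "?c (u' @ v') = ?c (u @ v)" if "u' \<in> ?c u" "v' \<in> ?c v" for u' v'
  proof -
    have "word_cong m n \<theta> (u @ v) (u' @ v')"
      using that by (intro word_cong_append) (simp_all add: word_rel_def)
    then show ?thesis
      by (intro equiv_class_eq[OF equiv_word_rel, symmetric]) (simp add: word_rel_def)
  qed
  have "?c u \<otimes>\<^bsub>F_theta m n \<theta>\<^esub> ?c v = (\<Union>u'\<in>?c u. \<Union>v'\<in>?c v. ?c (u' @ v'))"
    by (simp add: F_theta_def)
  also have "\<dots> = (\<Union>u'\<in>?c u. \<Union>v'\<in>?c v. ?c (u @ v))"
    by (intro SUP_cong HOL.refl eq)
  also have "\<dots> = ?c (u @ v)"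
    using equiv_class_self[OF equiv_word_rel assms(1)] equiv_class_self[OF equiv_word_rel assms(2)]
    by (simp only: UN_constant) (metis empty_iff)
  finally show ?thesis .
qed

lemma monoid_F_theta: "monoid (F_theta m n \<theta>)"
proof (rule monoidI)
  have nil: "[] \<in> words m n" and app: "\<And>u v. \<lbrakk>u \<in> words m n; v \<in> words m n\<rbrakk> \<Longrightarrow> u @ v \<in> words m n"
    by (auto simp: words_def)
  have car: "carrier (F_theta m n \<theta>) = words m n // word_rel m n \<theta>"
    and one: "\<one>\<^bsub>F_theta m n \<theta>\<^esub> = word_rel m n \<theta> `` {[]}"
    by (simp_all add: F_theta_def)
  show "\<one>\<^bsub>F_theta m n \<theta>\<^esub> \<in> carrier (F_theta m n \<theta>)"
    unfolding car one using nil by (rule quotientI)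
  fix x assume "x \<in> carrier (F_theta m n \<theta>)"
  then obtain u where u: "u \<in> words m n" "x = word_rel m n \<theta> `` {u}"
    unfolding car by (elim quotientE)
  show "\<one>\<^bsub>F_theta m n \<theta>\<^esub> \<otimes>\<^bsub>F_theta m n \<theta>\<^esub> x = x" "x \<otimes>\<^bsub>F_theta m n \<theta>\<^esub> \<one>\<^bsub>F_theta m n \<theta>\<^esub> = x"
    using u nil by (simp_all add: one F_theta_mult)
  fix y assume "y \<in> carrier (F_theta m n \<theta>)"
  then obtain v where v: "v \<in> words m n" "y = word_rel m n \<theta> `` {v}"
    unfolding car by (elim quotientE)
  show "x \<otimes>\<^bsub>F_theta m n \<theta>\<^esub> y \<in> carrier (F_theta m n \<theta>)"
    using u v app by (simp add: F_theta_mult) (simp add: car quotientI)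
  fix z assume "z \<in> carrier (F_theta m n \<theta>)"
  then obtain w where w: "w \<in> words m n" "z = word_rel m n \<theta> `` {w}"
    unfolding car by (elim quotientE)
  show "x \<otimes>\<^bsub>F_theta m n \<theta>\<^esub> y \<otimes>\<^bsub>F_theta m n \<theta>\<^esub> z =
        x \<otimes>\<^bsub>F_theta m n \<theta>\<^esub> (y \<otimes>\<^bsub>F_theta m n \<theta>\<^esub> z)"
    using u v w app by (simp add: F_theta_mult)
qed

lemma edge_commute:
  assumes "\<theta> permutes {1..m} \<times> {1..n}" "i \<in> {1..m}" "j \<in> {1..n}" "\<theta> (i, j) = (i', j')"
  shows "edge_e m n \<theta> i \<otimes>\<^bsub>F_theta m n \<theta>\<^esub> edge_f m n \<theta> j =
         edge_f m n \<theta> j' \<otimes>\<^bsub>F_theta m n \<theta>\<^esub> edge_e m n \<theta> i'"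
proof -
  have ij': "i' \<in> {1..m}" "j' \<in> {1..n}"
    using assms permutes_in_image[OF assms(1), of "(i, j)"] by auto
  then have "word_cong m n \<theta> [E i, F j] [F j', E i']"
    using word_cong.commute[of "[]" m n "[]" i j \<theta> i' j'] assms by (simp add: words_def)
  then have "word_rel m n \<theta> `` {[E i, F j]} = word_rel m n \<theta> `` {[F j', E i']}"
    by (intro equiv_class_eq[OF equiv_word_rel]) (simp add: word_rel_def)
  with assms ij' show ?thesis
    by (simp add: edge_e_def edge_f_def F_theta_mult words_def)
qed

section \<open>The algebra \<open>\<O>\<^sub>\<theta>\<close>\<close>

definition theta_family ::
  "nat \<Rightarrow> nat \<Rightarrow> (nat \<times> nat \<Rightarrow> nat \<times> nat) \<Rightarrow> 'a cstar \<Rightarrow> (edge list set \<Rightarrow> 'a) \<Rightarrow> bool" where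
  "theta_family m n \<theta> A s \<longleftrightarrow>
     s \<in> carrier (F_theta m n \<theta>) \<rightarrow> carrier A \<and>
     (\<forall>u\<in>carrier (F_theta m n \<theta>). (s u)\<^sup>\<star>\<^bsub>A\<^esub> \<otimes>\<^bsub>A\<^esub> s u = \<one>\<^bsub>A\<^esub>) \<and>
     s \<one>\<^bsub>F_theta m n \<theta>\<^esub> = \<one>\<^bsub>A\<^esub> \<and>
     (\<forall>u\<in>carrier (F_theta m n \<theta>). \<forall>v\<in>carrier (F_theta m n \<theta>).
        s (u \<otimes>\<^bsub>F_theta m n \<theta>\<^esub> v) = s u \<otimes>\<^bsub>A\<^esub> s v) \<and>
     (\<Oplus>\<^bsub>A\<^esub>i\<in>{1..m}. s (edge_e m n \<theta> i) \<otimes>\<^bsub>A\<^esub> (s (edge_e m n \<theta> i))\<^sup>\<star>\<^bsub>A\<^esub>) = \<one>\<^bsub>A\<^esub> \<and>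
     (\<Oplus>\<^bsub>A\<^esub>j\<in>{1..n}. s (edge_f m n \<theta> j) \<otimes>\<^bsub>A\<^esub> (s (edge_f m n \<theta> j))\<^sup>\<star>\<^bsub>A\<^esub>) = \<one>\<^bsub>A\<^esub>"

text \<open>\<open>(A, s)\<close> is (a copy of) \<open>\<O>\<^sub>\<theta>\<close> with its canonical generators.  HOL cannot quantify over
  types inside a definition, so the universal property is tested on the C*-algebras \<open>B\<close> whose
  carrier is a subset of the type \<open>'a\<close> that also contains the carrier of \<open>A\<close>.  This loses nothing:
  since \<open>A\<close> is nonzero, \<open>'a\<close> has at least the cardinality of the continuum; a family in a C*-algebra
  of any type generates a separable C*-algebra, which has at most that cardinality and hence has
  an isomorphic copy inside \<open>'a\<close>.  The condition \<open>\<one> \<noteq> \<zero>\<close> holds in \<open>\<O>\<^sub>\<theta>\<close> when \<open>m, n \<ge> 1\<close>; it only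
  rules out that the zero algebra qualifies because \<open>'a\<close> is too small.\<close>

definition is_O_theta ::
  "nat \<Rightarrow> nat \<Rightarrow> (nat \<times> nat \<Rightarrow> nat \<times> nat) \<Rightarrow> 'a cstar \<Rightarrow> (edge list set \<Rightarrow> 'a) \<Rightarrow> bool" where
  "is_O_theta m n \<theta> A s \<longleftrightarrow>
     unital_cstar_algebra A \<and> \<one>\<^bsub>A\<^esub> \<noteq> \<zero>\<^bsub>A\<^esub> \<and>
     theta_family m n \<theta> A s \<and>
     generates_cstar A (s ` carrier (F_theta m n \<theta>)) \<and>
     (\<forall>(B :: 'a cstar) t. unital_cstar_algebra B \<and> theta_family m n \<theta> B t \<longrightarrow>
        (\<exists>\<pi>\<in>unital_star_hom A B. \<forall>u\<in>carrier (F_theta m n \<theta>). \<pi> (s u) = t u))"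

section \<open>Twisted pairs of unitaries and endomorphisms\<close>

definition lambda_eps1 ::
  "nat \<Rightarrow> nat \<Rightarrow> (nat \<times> nat \<Rightarrow> nat \<times> nat) \<Rightarrow> 'a cstar \<Rightarrow> (edge list set \<Rightarrow> 'a) \<Rightarrow> 'a \<Rightarrow> 'a" where
  "lambda_eps1 m n \<theta> A s X =
     (\<Oplus>\<^bsub>A\<^esub>i\<in>{1..m}. s (edge_e m n \<theta> i) \<otimes>\<^bsub>A\<^esub> X \<otimes>\<^bsub>A\<^esub> (s (edge_e m n \<theta> i))\<^sup>\<star>\<^bsub>A\<^esub>)"

definition lambda_eps2 ::
  "nat \<Rightarrow> nat \<Rightarrow> (nat \<times> nat \<Rightarrow> nat \<times> nat) \<Rightarrow> 'a cstar \<Rightarrow> (edge list set \<Rightarrow> 'a) \<Rightarrow> 'a \<Rightarrow> 'a" where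
  "lambda_eps2 m n \<theta> A s X =
     (\<Oplus>\<^bsub>A\<^esub>j\<in>{1..n}. s (edge_f m n \<theta> j) \<otimes>\<^bsub>A\<^esub> X \<otimes>\<^bsub>A\<^esub> (s (edge_f m n \<theta> j))\<^sup>\<star>\<^bsub>A\<^esub>)"

definition twisted_pairs ::
  "nat \<Rightarrow> nat \<Rightarrow> (nat \<times> nat \<Rightarrow> nat \<times> nat) \<Rightarrow> 'a cstar \<Rightarrow> (edge list set \<Rightarrow> 'a) \<Rightarrow> ('a \<times> 'a) set" where
  "twisted_pairs m n \<theta> A s =
     {(U, V). U \<in> unitaries A \<and> V \<in> unitaries A \<and>
        U \<otimes>\<^bsub>A\<^esub> lambda_eps1 m n \<theta> A s V = V \<otimes>\<^bsub>A\<^esub> lambda_eps2 m n \<theta> A s U}"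

definition lambda_end ::
  "nat \<Rightarrow> nat \<Rightarrow> (nat \<times> nat \<Rightarrow> nat \<times> nat) \<Rightarrow> 'a cstar \<Rightarrow> (edge list set \<Rightarrow> 'a) \<Rightarrow> 'a \<times> 'a \<Rightarrow> 'a \<Rightarrow> 'a" where
  "lambda_end m n \<theta> A s = (\<lambda>(U, V). THE \<phi>.
     \<phi> \<in> carrier (End_monoid A) \<and>
     (\<forall>i\<in>{1..m}. \<phi> (s (edge_e m n \<theta> i)) = U \<otimes>\<^bsub>A\<^esub> s (edge_e m n \<theta> i)) \<and>
     (\<forall>j\<in>{1..n}. \<phi> (s (edge_f m n \<theta> j)) = V \<otimes>\<^bsub>A\<^esub> s (edge_f m n \<theta> j)))"

definition twisted_monoid ::
  "nat \<Rightarrow> nat \<Rightarrow> (nat \<times> nat \<Rightarrow> nat \<times> nat) \<Rightarrow> 'a cstar \<Rightarrow> (edge list set \<Rightarrow> 'a) \<Rightarrow> ('a \<times> 'a) monoid" where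
  "twisted_monoid m n \<theta> A s =
     \<lparr>carrier = twisted_pairs m n \<theta> A s,
      monoid.mult = (\<lambda>(U2, V2) (U1, V1).
        (lambda_end m n \<theta> A s (U2, V2) U1 \<otimes>\<^bsub>A\<^esub> U2,
         lambda_end m n \<theta> A s (U2, V2) V1 \<otimes>\<^bsub>A\<^esub> V2)),
      one = (\<one>\<^bsub>A\<^esub>, \<one>\<^bsub>A\<^esub>)\<rparr>"

end

theory Submission
  imports Defs
begin

text \<open>
  A *-homomorphism is bounded: for self-adjoint \<open>a\<close> of norm at most \<open>1/2\<close>, Banach's fixed point
  theorem gives a self-adjoint \<open>b\<close> with \<open>a\<^sup>2 + b\<^sup>2 = 1\<close> commuting with \<open>a\<close>, so \<open>h a + \<i> h b\<close> is an isometry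
  and \<open>h a\<close> has norm at most 1.  Hence an endomorphism of \<open>\<O>\<^sub>\<theta>\<close> is determined by its values on the
  \<open>s\<^sub>e\<close> and \<open>s\<^sub>f\<close>.

  The isometries \<open>s\<^sub>e\<close> have orthogonal ranges, so every \<open>\<phi>\<close> is implemented on them by the unitary
  \<open>U = \<Sum> \<phi>(s\<^sub>e) s\<^sub>e\<^sup>*\<close>, and likewise on the \<open>s\<^sub>f\<close> by some \<open>V\<close>.  Given unitaries \<open>U\<close> and \<open>V\<close>, the elements
  \<open>U s\<^sub>e\<close> and \<open>V s\<^sub>f\<close> satisfy the commutation relations iff the pair is twisted, as one sees by
  multiplying the twist equation by \<open>s\<^sub>e s\<^sub>f\<close>.  So \<open>\<Psi>\<close> is a bijection, and the product on
  pairs is the composition of endomorphisms read through \<open>\<Psi>\<close>; the monoid laws are transported.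
\<close>

subsection \<open>Arithmetic in C*-algebras\<close>

lemma complex_ring_simps:
  "carrier complex_ring = UNIV" "x \<otimes>\<^bsub>complex_ring\<^esub> y = x * y" "\<one>\<^bsub>complex_ring\<^esub> = 1"
  "\<zero>\<^bsub>complex_ring\<^esub> = 0" "x \<oplus>\<^bsub>complex_ring\<^esub> y = x + y"
  by (simp_all add: complex_ring_def)

context unital_cstar_algebra
begin

lemma ring_A: "ring A" ..

lemma semiring_A: "semiring A" ..

text \<open>Within the locale, the unqualified names of ring facts refer to \<open>complex_ring\<close>, not to \<open>A\<close>.\<close>

lemmas A_ring_simps = ring.ring_simprules[OF ring_A]
lemmas A_assoc = A_ring_simps(11)
lemmas A_abelian_monoid = abelian_group.axioms(1)[OF ring.is_abelian_group[OF ring_A]]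
lemmas A_finsum_closed = abelian_monoid.finsum_closed[OF A_abelian_monoid]
lemmas A_finsum_insert = abelian_monoid.finsum_insert[OF A_abelian_monoid]
lemmas A_finsum_empty = abelian_monoid.finsum_empty[OF A_abelian_monoid]
lemmas A_finsum_ldistr = semiring.finsum_ldistr[OF semiring_A]
lemmas A_finsum_rdistr = semiring.finsum_rdistr[OF semiring_A]
lemmas A_finsum_cong = abelian_monoid.finsum_cong'[OF A_abelian_monoid]

section \<open>Scalar multiples and normal forms of linear combinations\<close>

lemma smult_in_carrier [simp]: "x \<in> carrier A \<Longrightarrow> c \<odot> x \<in> carrier A"
  by (rule smult_closed) (simp_all add: complex_ring_simps)

lemma smult_0 [simp]: "x \<in> carrier A \<Longrightarrow> 0 \<odot> x = \<zero>"
  using smult_l_null by (simp add: complex_ring_simps)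

lemma smult_1 [simp]: "x \<in> carrier A \<Longrightarrow> 1 \<odot> x = x"
  using smult_one by (simp add: complex_ring_simps)

lemma smult_add_left: "x \<in> carrier A \<Longrightarrow> (c + d) \<odot> x = c \<odot> x \<oplus> d \<odot> x"
  using smult_l_distr[of c d x] by (simp add: complex_ring_simps)

lemma smult_add_right: "\<lbrakk>x \<in> carrier A; y \<in> carrier A\<rbrakk> \<Longrightarrow> c \<odot> (x \<oplus> y) = c \<odot> x \<oplus> c \<odot> y"
  using smult_r_distr[of c x y] by (simp add: complex_ring_simps)

lemma smult_smult [simp]: "x \<in> carrier A \<Longrightarrow> c \<odot> (d \<odot> x) = (c * d) \<odot> x"
  using smult_assoc1[of c d x] by (simp add: complex_ring_simps)

lemma smult_zero [simp]: "c \<odot> \<zero> = \<zero>"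
  using smult_smult[of \<zero> c 0] by (simp add: A_ring_simps)

lemma uminus_smult: 
  assumes "x \<in> carrier A" shows "\<ominus> x = (-1) \<odot> x"
proof -
  have "x \<oplus> (-1) \<odot> x = \<zero>"
    using smult_add_left[of x 1 "-1"] assms by simp
  then show ?thesis
    using assms by (metis A_ring_simps(15) A_ring_simps(18) A_ring_simps(3) smult_in_carrier)
qed

lemma minus_smult: "\<lbrakk>x \<in> carrier A; y \<in> carrier A\<rbrakk> \<Longrightarrow> x \<ominus> y = x \<oplus> (-1) \<odot> y"
  by (simp add: A_ring_simps uminus_smult)

text \<open>Together with the next lemma these are rewrite rules that merge adjacent multiples of
  the same monomial in a sorted sum. They let \<open>lin_simps\<close> decide polynomial identities
  in which multiplication stays noncommutative.\<close>

lemma smult_collect: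
  assumes "x \<in> carrier A"
  shows "c \<odot> x \<oplus> d \<odot> x = (c + d) \<odot> x" "x \<oplus> d \<odot> x = (1 + d) \<odot> x"
    "c \<odot> x \<oplus> x = (c + 1) \<odot> x" "x \<oplus> x = 2 \<odot> x"
  using assms smult_add_left[of x 1 1] by (simp_all add: smult_add_left)

lemma smult_collect_left:
  assumes "x \<in> carrier A" "z \<in> carrier A"
  shows "c \<odot> x \<oplus> (d \<odot> x \<oplus> z) = (c + d) \<odot> x \<oplus> z" "x \<oplus> (d \<odot> x \<oplus> z) = (1 + d) \<odot> x \<oplus> z"
    "c \<odot> x \<oplus> (x \<oplus> z) = (c + 1) \<odot> x \<oplus> z" "x \<oplus> (x \<oplus> z) = 2 \<odot> x \<oplus> z"
  using assms by (simp_all add: smult_collect[symmetric] A_ring_simps del: smult_collect(4))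

text \<open>Ordered rewriting of a sum can leave another monomial \<open>w\<close> between two
  multiples of \<open>x\<close>; these instances bring them together.\<close>

lemma smult_collect_apart:
  assumes "x \<in> carrier A" "w \<in> carrier A"
  shows "x \<oplus> (w \<oplus> d \<odot> x) = w \<oplus> (1 + d) \<odot> x"
    and "z \<in> carrier A \<Longrightarrow> c \<odot> x \<oplus> (w \<oplus> (d \<odot> x \<oplus> z)) = w \<oplus> ((c + d) \<odot> x \<oplus> z)"
  using assms A_ring_simps(22)[of x w "d \<odot> x"] A_ring_simps(22)[of "c \<odot> x" w "d \<odot> x \<oplus> z"]
  by (simp_all add: smult_collect smult_collect_left)

lemmas lin_simps = A_ring_simps(1,2,5-8,10-13,15,22-25) minus_smult uminus_smult smult_mult_left smult_mult_right
  smult_add_right smult_collect smult_collect_left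

declare star_closed [simp] star_star [simp]

section \<open>The involution and the norm\<close>

lemma star_one [simp]: "\<one>\<^sup>\<star> = \<one>"
  using star_mult[of "\<one>\<^sup>\<star>" "\<one>"] by (simp add: A_ring_simps)

lemma star_zero [simp]: "\<zero>\<^sup>\<star> = \<zero>"
  using star_smult[of \<zero> 0] by (simp add: A_ring_simps)

lemma star_minus: "\<lbrakk>x \<in> carrier A; y \<in> carrier A\<rbrakk> \<Longrightarrow> (x \<ominus> y)\<^sup>\<star> = x\<^sup>\<star> \<ominus> y\<^sup>\<star>"
  by (simp add: minus_smult star_add star_smult)

lemma star_finsum:
  "\<lbrakk>finite I; f \<in> I \<rightarrow> carrier A\<rbrakk> \<Longrightarrow> (\<Oplus>i\<in>I. f i)\<^sup>\<star> = (\<Oplus>i\<in>I. (f i)\<^sup>\<star>)"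
  by (induction I rule: finite_induct)
    (auto simp: A_finsum_insert A_finsum_empty star_add A_finsum_closed Pi_iff)

lemma cnorm_zero [simp]: "cnorm A \<zero> = 0"
  by (simp add: cnorm_eq_zero A_ring_simps)

text \<open>Follows from the triangle inequality for \<open>x\<close> and
  \<open>(-1) \<odot> x\<close>, whose sum is zero.\<close>

lemma cnorm_nonneg [simp]: "x \<in> carrier A \<Longrightarrow> 0 \<le> cnorm A x"
  using cnorm_triangle[of x "(-1) \<odot> x"] cnorm_smult[of x "-1"] by (simp add: smult_collect)

lemma cnorm_minus_le: "\<lbrakk>x \<in> carrier A; y \<in> carrier A\<rbrakk> \<Longrightarrow> cnorm A (x \<ominus> y) \<le> cnorm A x + cnorm A y"
  using cnorm_triangle[of x "(-1) \<odot> y"] cnorm_smult[of y "-1"] by (simp add: minus_smult)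

lemma cnorm_minus_commute: "\<lbrakk>x \<in> carrier A; y \<in> carrier A\<rbrakk> \<Longrightarrow> cnorm A (x \<ominus> y) = cnorm A (y \<ominus> x)"
  using cnorm_smult[of "x \<ominus> y" "-1"] by (simp add: minus_smult smult_add_right A_ring_simps(10) )

lemma minus_self [simp]: "x \<in> carrier A \<Longrightarrow> x \<ominus> x = \<zero>"
  by (simp add: A_ring_simps)

lemma minus_zero_right: "x \<in> carrier A \<Longrightarrow> x \<ominus> \<zero> = x"
  by (simp add: A_ring_simps)

lemma minus_eq_zero_iff: "\<lbrakk>x \<in> carrier A; y \<in> carrier A\<rbrakk> \<Longrightarrow> x \<ominus> y = \<zero> \<longleftrightarrow> x = y"
  by (metis A_ring_simps(10,14,18,20) A_ring_simps(15) A_ring_simps(3) minus_self)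

lemma cnorm_minus_eq_0: "\<lbrakk>x \<in> carrier A; y \<in> carrier A\<rbrakk> \<Longrightarrow> cnorm A (x \<ominus> y) = 0 \<longleftrightarrow> x = y"
  by (simp add: cnorm_eq_zero minus_eq_zero_iff)

lemma cnorm_minus_triangle:
  "\<lbrakk>x \<in> carrier A; y \<in> carrier A; z \<in> carrier A\<rbrakk> \<Longrightarrow> cnorm A (x \<ominus> z) \<le> cnorm A (x \<ominus> y) + cnorm A (y \<ominus> z)"
  using cnorm_triangle[of "x \<ominus> y" "y \<ominus> z"] by (simp add: lin_simps)

text \<open>The C*-identity gives \<open>(cnorm A y)\<^sup>2 \<le> cnorm A (y\<^sup>\<star>) * cnorm
  A y\<close>. Cancelling a factor and applying the result to both \<open>x\<close> and its adjoint
  gives equality.\<close>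

lemma cnorm_star [simp]:
  assumes "x \<in> carrier A" shows "cnorm A (x\<^sup>\<star>) = cnorm A x"
proof -
  have *: "cnorm A y \<le> cnorm A (y\<^sup>\<star>)" if y: "y \<in> carrier A" for y
  proof (cases "cnorm A y = 0")
    case False
    have "cnorm A y * cnorm A y \<le> cnorm A (y\<^sup>\<star>) * cnorm A y"
      using cstar_identity[of y] cnorm_mult[of "y\<^sup>\<star>" y] y by (simp add: power2_eq_square)
    with False y show ?thesis
      by (metis cnorm_nonneg mult_le_cancel_right order_le_less)
  qed (use y in simp)
  show ?thesis using *[of x] *[of "x\<^sup>\<star>"] assms by simp
qed

text \<open>The norm of the unit equals its own square, so it is 0 or 1. The value 0 occurs in the
  zero algebra, hence an inequality.\<close>

lemma cnorm_isometry_le_1: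
  assumes "x \<in> carrier A" "x\<^sup>\<star> \<otimes> x = \<one>" shows "cnorm A x \<le> 1"
proof -
  have "cnorm A \<one> = (cnorm A \<one>)\<^sup>2"
    using cstar_identity[of \<one>] by (simp add: A_ring_simps)
  then have "cnorm A \<one> \<le> 1" by (auto simp: power2_eq_square)
  then have "(cnorm A x)\<^sup>2 \<le> 1" using cstar_identity[of x] assms by simp
  then show ?thesis by (simp add: power2_le_iff_abs_le abs_square_le_1)
qed

lemma cnorm_one_le_1: "cnorm A \<one> \<le> 1"
  by (rule cnorm_isometry_le_1) (simp_all add: A_ring_simps)

lemma cnorm_mult_le:
  "\<lbrakk>x \<in> carrier A; y \<in> carrier A; cnorm A x \<le> a; cnorm A y \<le> b\<rbrakk> \<Longrightarrow> cnorm A (x \<otimes> y) \<le> a * b"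
  by (meson cnorm_mult cnorm_nonneg mult_mono order_trans)

lemma cnorm_add_le:
  "\<lbrakk>x \<in> carrier A; y \<in> carrier A; cnorm A x \<le> a; cnorm A y \<le> b\<rbrakk> \<Longrightarrow> cnorm A (x \<oplus> y) \<le> a + b"
  using cnorm_triangle by fastforce

text \<open>The single equation says that \<open>x\<close> is a projection: the left side is
  self-adjoint, so \<open>x\<close> is, and then \<open>x\<close> is idempotent.\<close>

lemma cnorm_projection_le_1:
  assumes "x \<in> carrier A" "x\<^sup>\<star> \<otimes> x = x" shows "cnorm A x \<le> 1"
  using cstar_identity[of x] assms by (auto simp: power2_eq_square)

text \<open>Serves to pass equations to limits: \<open>e k\<close> will be the distance of an
  approximating sequence from its limit.\<close>

lemma eqI_of_cnorm_null:
  assumes "x \<in> carrier A" "y \<in> carrier A" "e \<longlonglongrightarrow> 0" "\<And>k. cnorm A (x \<ominus> y) \<le> C * e k"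
  shows "x = y"
proof -
  have "(\<lambda>k. C * e k) \<longlonglongrightarrow> 0" using tendsto_mult_right_zero[OF assms(3)] .
  then have "cnorm A (x \<ominus> y) \<le> 0" using assms(4) by (intro LIMSEQ_le_const) auto
  then have "cnorm A (x \<ominus> y) = 0" using assms by (simp add: order_antisym)
  then show ?thesis using assms by (simp add: cnorm_minus_eq_0)
qed

subsection \<open>Square roots and positivity\<close>

text \<open>\<open>b = 1 - y\<close>, where \<open>y\<close> is the fixed point of \<open>y \<mapsto> (a\<^sup>2 + y\<^sup>2) / 2\<close>.\<close>

lemma sqrt_exists:
  assumes a: "a \<in> carrier A" "a\<^sup>\<star> = a" and le: "cnorm A a \<le> 1/2"
  obtains b where "b \<in> carrier A" "b\<^sup>\<star> = b" "a \<otimes> b = b \<otimes> a" "a \<otimes> a \<oplus> b \<otimes> b = \<one>"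
proof -
  \<comment> \<open>The radius 1/4 is preserved by \<open>f\<close> because (1/4 + 1/16)/2 \<le>
    1/4, and on this ball \<open>f\<close> contracts by (1/4 + 1/4)/2 = 1/4. The algebraic
    conditions are put into \<open>M\<close> so that the fixed point inherits them.\<close>
  define M where "M = {y \<in> carrier A. y\<^sup>\<star> = y \<and> a \<otimes> y = y \<otimes> a \<and> cnorm A y \<le> 1/4}"
  define f where "f y = (1/2) \<odot> (a \<otimes> a \<oplus> y \<otimes> y)" for y
  have Mc: "M \<subseteq> carrier A" by (auto simp: M_def)
  \<comment> \<open>\<open>Metric_space\<close> demands nonnegativity and symmetry at all arguments,
    hence the value 0 off \<open>M\<close>.\<close>
  define d where "d x y = (if x \<in> M \<and> y \<in> M then cnorm A (x \<ominus> y) else 0)" for x y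
  interpret Metric_space M d
    using Mc by unfold_locales
      (auto simp: d_def cnorm_minus_commute cnorm_minus_eq_0 cnorm_minus_triangle subset_iff)
  have "mcomplete"
    unfolding mcomplete_def
  proof (intro allI impI)
    fix \<sigma> assume \<sigma>: "MCauchy \<sigma>"
    then have \<sigma>M: "\<sigma> k \<in> M" for k by (auto simp: MCauchy_def)
    then have sc: "\<sigma> k \<in> carrier A" "(\<sigma> k)\<^sup>\<star> = \<sigma> k" "a \<otimes> \<sigma> k = \<sigma> k \<otimes> a" "cnorm A (\<sigma> k) \<le> 1/4" for k
      by (auto simp: M_def)
    obtain x where x: "x \<in> carrier A" and lim: "(\<lambda>k. cnorm A (\<sigma> k \<ominus> x)) \<longlonglongrightarrow> 0"
      using complete[of \<sigma>] \<sigma> sc(1) \<sigma>M by (auto simp: MCauchy_def d_def)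
    \<comment> \<open>The limit stays in \<open>M\<close>: the defect in each equation is at most a
      constant times the distance from \<open>\<sigma> k\<close> to \<open>x\<close>.\<close>
    have "cnorm A (x\<^sup>\<star> \<ominus> x) \<le> 2 * cnorm A (\<sigma> k \<ominus> x)" for k
    proof -
      have "cnorm A (x\<^sup>\<star> \<ominus> x) \<le> cnorm A (x\<^sup>\<star> \<ominus> \<sigma> k) + cnorm A (\<sigma> k \<ominus> x)"
        using sc x by (intro cnorm_minus_triangle) auto
      also have "cnorm A (x\<^sup>\<star> \<ominus> \<sigma> k) = cnorm A (\<sigma> k \<ominus> x)"
        using cnorm_star[of "x \<ominus> \<sigma> k"] star_minus[of x "\<sigma> k"] sc x by (simp add: cnorm_minus_commute)
      finally show ?thesis by simp
    qed
    then have 1: "x\<^sup>\<star> = x" using x lim by (intro eqI_of_cnorm_null) auto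
    have "cnorm A (a \<otimes> x \<ominus> x \<otimes> a) \<le> 2 * cnorm A a * cnorm A (\<sigma> k \<ominus> x)" for k
    proof -
      have "a \<otimes> x \<ominus> x \<otimes> a = (\<sigma> k \<ominus> x) \<otimes> a \<ominus> a \<otimes> (\<sigma> k \<ominus> x)"
        using sc(1)[of k] sc(3)[of k] x a by (simp add: lin_simps smult_collect_apart)
      then have "cnorm A (a \<otimes> x \<ominus> x \<otimes> a) \<le> cnorm A ((\<sigma> k \<ominus> x) \<otimes> a) + cnorm A (a \<otimes> (\<sigma> k \<ominus> x))"
        using sc x a by (simp add: cnorm_minus_le)
      also have "\<dots> \<le> cnorm A (\<sigma> k \<ominus> x) * cnorm A a + cnorm A a * cnorm A (\<sigma> k \<ominus> x)"
        using sc x a by (intro add_mono cnorm_mult) auto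
      finally show ?thesis by (simp add: mult_ac)
    qed
    then have 2: "a \<otimes> x = x \<otimes> a" using x a lim by (intro eqI_of_cnorm_null) auto
    have "cnorm A x \<le> 1/4"
    proof (rule LIMSEQ_le_const)
      show "(\<lambda>k. 1/4 + cnorm A (\<sigma> k \<ominus> x)) \<longlonglongrightarrow> 1/4" using tendsto_add[OF tendsto_const lim] by simp
      have "cnorm A x \<le> 1/4 + cnorm A (\<sigma> k \<ominus> x)" for k
        using cnorm_minus_triangle[of x "\<sigma> k" \<zero>] sc(1,4)[of k] x cnorm_minus_commute[of x "\<sigma> k"]
        by (simp add: minus_zero_right)
      then show "\<exists>N. \<forall>k\<ge>N. cnorm A x \<le> 1/4 + cnorm A (\<sigma> k \<ominus> x)" by blast
    qed
    with 1 2 x have "x \<in> M" by (simp add: M_def)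
    moreover have "\<forall>\<epsilon>>0. \<exists>N. \<forall>n\<ge>N. cnorm A (\<sigma> n \<ominus> x) < \<epsilon>"
      using lim sc x by (simp add: LIMSEQ_iff)
    ultimately show "\<exists>x. limitin mtopology \<sigma> x sequentially"
      unfolding limit_metric_sequentially using \<sigma>M by (auto simp: d_def)
  qed
  moreover have "\<zero> \<in> M" using a by (simp add: M_def A_ring_simps)
  then have "M \<noteq> {}" by blast
  moreover have "f \<in> M \<rightarrow> M"
  proof
    fix y assume "y \<in> M"
    then have y: "y \<in> carrier A" "y\<^sup>\<star> = y" "a \<otimes> y = y \<otimes> a" "cnorm A y \<le> 1/4"
      by (auto simp: M_def)
    have "a \<otimes> (y \<otimes> y) = (y \<otimes> y) \<otimes> a"
      using y a by (metis A_assoc)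
    then have "a \<otimes> f y = f y \<otimes> a"
      unfolding f_def using y a by (simp add: lin_simps)
    moreover have "(f y)\<^sup>\<star> = f y"
      using y a by (simp add: f_def star_smult star_add star_mult)
    moreover have "cnorm A (f y) \<le> 1/4"
    proof -
      have "cnorm A (a \<otimes> a \<oplus> y \<otimes> y) \<le> (1/2)*(1/2) + (1/4)*(1/4)"
        using y a le by (intro cnorm_add_le cnorm_mult_le) auto
      then show ?thesis using y a by (simp add: f_def cnorm_smult)
    qed
    ultimately show "f y \<in> M" using y a by (simp add: M_def f_def)
  qed
  moreover have "d (f x) (f y) \<le> 1/4 * d x y" if "x \<in> M" "y \<in> M" for x y
  proof -
    from that have xy: "x \<in> carrier A" "y \<in> carrier A" "cnorm A x \<le> 1/4" "cnorm A y \<le> 1/4"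
      by (auto simp: M_def)
    have "f x \<ominus> f y = (1/2) \<odot> (x \<otimes> (x \<ominus> y) \<oplus> (x \<ominus> y) \<otimes> y)"
      using xy a by (simp add: f_def lin_simps smult_collect_apart)
    moreover have "cnorm A (x \<otimes> (x \<ominus> y) \<oplus> (x \<ominus> y) \<otimes> y)
        \<le> 1/4 * cnorm A (x \<ominus> y) + cnorm A (x \<ominus> y) * (1/4)"
      using xy by (intro cnorm_add_le cnorm_mult_le) auto
    ultimately show ?thesis using xy that \<open>f \<in> M \<rightarrow> M\<close> by (simp add: d_def Pi_iff cnorm_smult)
  qed
  ultimately obtain y where "y \<in> M" and fixpoint: "f y = y"
    by - (rule Banach_fixedpoint_thm[of f "1/4"], auto)
  then have y: "y \<in> carrier A" "y\<^sup>\<star> = y" "a \<otimes> y = y \<otimes> a" by (auto simp: M_def)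
  \<comment> \<open>At the fixed point the sum of the squares of \<open>a\<close> and
    \<open>y\<close> is \<open>2 \<odot> y\<close>, which cancels the cross term in the square of
    \<open>\<one> \<ominus> y\<close>.\<close>
  have "a \<otimes> a \<oplus> y \<otimes> y = 2 \<odot> f y"
    using a y by (simp add: f_def)
  then have eq: "a \<otimes> a \<oplus> y \<otimes> y = 2 \<odot> y" by (simp add: fixpoint)
  show ?thesis
  proof
    show "\<one> \<ominus> y \<in> carrier A" "(\<one> \<ominus> y)\<^sup>\<star> = \<one> \<ominus> y" using y by (simp_all add: star_minus)
    show "a \<otimes> (\<one> \<ominus> y) = (\<one> \<ominus> y) \<otimes> a" using y a by (simp add: lin_simps)
    have "a \<otimes> a \<oplus> (\<one> \<ominus> y) \<otimes> (\<one> \<ominus> y) = (a \<otimes> a \<oplus> y \<otimes> y) \<oplus> (\<one> \<oplus> (-2) \<odot> y)"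
      using y a by (simp add: lin_simps)
    also have "\<dots> = \<one>" unfolding eq using y by (simp add: lin_simps)
    finally show "a \<otimes> a \<oplus> (\<one> \<ominus> y) \<otimes> (\<one> \<ominus> y) = \<one>" .
  qed
qed

text \<open>Since \<open>x\<close> and \<open>y\<close> commute,
  \<open>x \<oplus> \<i> \<odot> y\<close> is an isometry, and \<open>x\<close> is the mean of it
  and its adjoint.\<close>

lemma cnorm_le_1_if_sum_squares:
  assumes "x \<in> carrier A" "x\<^sup>\<star> = x" "y \<in> carrier A" "y\<^sup>\<star> = y" "x \<otimes> y = y \<otimes> x"
    and "x \<otimes> x \<oplus> y \<otimes> y = \<one>"
  shows "cnorm A x \<le> 1"
proof -
  define u where "u = x \<oplus> \<i> \<odot> y"
  have u: "u \<in> carrier A" "u\<^sup>\<star> = x \<oplus> (- \<i>) \<odot> y"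
    using assms by (simp_all add: u_def star_add star_smult)
  have "u\<^sup>\<star> \<otimes> u = x \<otimes> x \<oplus> y \<otimes> y"
    unfolding u(2) using assms(1-5) by (simp add: u_def lin_simps)
  then have "cnorm A u \<le> 1" using u assms(6) by (simp add: cnorm_isometry_le_1)
  moreover have "2 \<odot> x = u \<oplus> u\<^sup>\<star>"
    unfolding u(2) using assms(1-5) by (simp add: u_def lin_simps)
  then have "2 * cnorm A x \<le> cnorm A u + cnorm A (u\<^sup>\<star>)"
    using assms u(1) by (metis cnorm_smult cnorm_triangle norm_numeral star_closed)
  ultimately show ?thesis using u(1) by simp
qed

section \<open>Vanishing sums of positive elements\<close>

text \<open>If \<open>1 + z x\<close> and \<open>1 + \<i> z x\<close> lie in the unit ball, so does the mean \<open>1 + (1 + \<i>) z x\<close> of their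
  squares.  Iterating from \<open>z \<in> {1, -1, \<i>, -\<i>}\<close> shows that arbitrarily large multiples of \<open>x\<close> are bounded.\<close>

lemma zero_if_cnorm_one_pm_le_1:
  assumes x: "x \<in> carrier A" "x\<^sup>\<star> = x" and le: "cnorm A (\<one> \<oplus> x) \<le> 1" "cnorm A (\<one> \<ominus> x) \<le> 1"
  shows "x = \<zero>"
proof -
  define Q where "Q z \<longleftrightarrow> cnorm A (\<one> \<oplus> z \<odot> x) \<le> 1" for z
  have half: "cnorm A ((1/2) \<odot> (u \<otimes> u \<oplus> v \<otimes> v)) \<le> 1"
    if "u \<in> carrier A" "v \<in> carrier A" "cnorm A u \<le> 1" "cnorm A v \<le> 1" for u v
    using cnorm_add_le[of "u \<otimes> u" "v \<otimes> v" "1*1" "1*1"] cnorm_mult_le[of u u 1 1] cnorm_mult_le[of v v 1 1] that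
    by (simp add: cnorm_smult)
  have Q1: "Q 1" "Q (-1)" using le x by (simp_all add: Q_def minus_smult)
  have Qi: "Q \<i>"
  proof -
    define u where "u = \<one> \<oplus> \<i> \<odot> x"
    have "u\<^sup>\<star> = \<one> \<oplus> (- \<i>) \<odot> x" "u \<in> carrier A" using x by (simp_all add: u_def star_add star_smult)
    \<comment> \<open>Both sides equal 1 + x^2: the linear terms cancel in the product on the left
      and in the mean on the right.\<close>
    then have "u\<^sup>\<star> \<otimes> u = (1/2) \<odot> ((\<one> \<oplus> x) \<otimes> (\<one> \<oplus> x) \<oplus> (\<one> \<ominus> x) \<otimes> (\<one> \<ominus> x))"
      using x by (simp add: u_def lin_simps)
    then have "cnorm A (u\<^sup>\<star> \<otimes> u) \<le> 1" using x half le by simp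
    with \<open>u \<in> carrier A\<close> have "(cnorm A u)\<^sup>2 \<le> 1" by (simp add: cstar_identity)
    then show ?thesis using \<open>u \<in> carrier A\<close> by (simp add: abs_square_le_1 Q_def flip: u_def)
  qed
  have Qmi: "Q (-\<i>)"
    using Qi cnorm_star[of "\<one> \<oplus> \<i> \<odot> x"] x by (simp add: Q_def star_add star_smult)
  have step: "Q ((1 + \<i>) * z)" if "Q z" "Q (\<i> * z)" for z
  proof -
    \<comment> \<open>The quadratic terms cancel because the square of \<open>\<i> * z\<close> is
      minus that of \<open>z\<close>.\<close>
    have "\<one> \<oplus> ((1 + \<i>) * z) \<odot> x =
      (1/2) \<odot> ((\<one> \<oplus> z \<odot> x) \<otimes> (\<one> \<oplus> z \<odot> x) \<oplus> (\<one> \<oplus> (\<i> * z) \<odot> x) \<otimes> (\<one> \<oplus> (\<i> * z) \<odot> x))"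
      using x by (simp add: lin_simps algebra_simps)
    then show ?thesis using that half x by (simp add: Q_def)
  qed
  have i_powers: "\<i> ^ k \<in> {1, -1, \<i>, -\<i>}" for k
    by (induction k) auto
  \<comment> \<open>The extra factor \<open>\<i> ^ k\<close> makes the induction hypothesis cover
    \<open>\<i> * z\<close> as well as \<open>z\<close>, as \<open>step\<close> requires.\<close>
  have "Q ((1 + \<i>) ^ n * \<i> ^ k)" for n k
  proof (induction n arbitrary: k)
    case 0
    then show ?case using i_powers[of k] Q1 Qi Qmi by auto
  next
    case (Suc n)
    show ?case using step[OF Suc[of k]] Suc[of "Suc k"] by (simp add: mult_ac)
  qed
  from this[of _ 0] have Qn: "Q ((1 + \<i>) ^ n)" for n by simp
  have bound: "sqrt 2 ^ n * cnorm A x \<le> 2" for n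
  proof -
    have "cnorm A ((1 + \<i>) ^ n \<odot> x) = sqrt 2 ^ n * cnorm A x"
      using x by (simp add: cnorm_smult norm_power) (simp add: cmod_def)
    moreover have "(1 + \<i>) ^ n \<odot> x = (\<one> \<oplus> (1 + \<i>) ^ n \<odot> x) \<ominus> \<one>"
      using x by (simp add: lin_simps)
    then have "cnorm A ((1 + \<i>) ^ n \<odot> x) \<le> cnorm A (\<one> \<oplus> (1 + \<i>) ^ n \<odot> x) + cnorm A \<one>"
      using x by (metis A_ring_simps(1,6) cnorm_minus_le smult_in_carrier)
    ultimately show ?thesis using Qn[of n] cnorm_one_le_1 by (simp add: Q_def)
  qed
  have "cnorm A x = 0"
  proof (rule ccontr)
    assume "cnorm A x \<noteq> 0"
    then have pos: "cnorm A x > 0" using x by (simp add: order_less_le)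
    obtain n where "2 / cnorm A x < sqrt 2 ^ n"
      using real_arch_pow[of "sqrt 2"] by auto
    with pos bound[of n] show False by (simp add: field_simps)
  qed
  then show ?thesis using x by (simp add: cnorm_eq_zero)
qed

text \<open>The element splits into the terms \<open>\<one> \<ominus> y k\<close> and T - |J| times
  the unit, each bounded by the triangle inequality. \<open>T\<close> may exceed the number of terms
  so that one value serves several subsets of an index set.\<close>

lemma cnorm_shift_sum_le:
  assumes "finite J" "y \<in> J \<rightarrow> carrier A" "\<And>k. k \<in> J \<Longrightarrow> cnorm A (\<one> \<ominus> y k) \<le> 1" "real (card J) \<le> T"
  shows "cnorm A (complex_of_real T \<odot> \<one> \<ominus> (\<Oplus>k\<in>J. y k)) \<le> T"
  using assms
proof (induction J arbitrary: T rule: finite_induct)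
  case empty
  have "\<bar>T\<bar> * cnorm A \<one> \<le> T * 1"
    using empty cnorm_one_le_1 by (intro mult_mono) auto
  then show ?case by (simp add: A_finsum_empty lin_simps cnorm_smult)
next
  case (insert j J)
  let ?S = "\<Oplus>k\<in>J. y k"
  have y: "y j \<in> carrier A" "y \<in> J \<rightarrow> carrier A" using insert by auto
  then have S: "?S \<in> carrier A" by (intro A_finsum_closed)
  have "complex_of_real T \<odot> \<one> = \<one> \<oplus> complex_of_real (T - 1) \<odot> \<one>"
    by (simp add: smult_collect)
  then have "complex_of_real T \<odot> \<one> \<ominus> (\<Oplus>k\<in>insert j J. y k)
      = (\<one> \<ominus> y j) \<oplus> (complex_of_real (T - 1) \<odot> \<one> \<ominus> ?S)"
    using insert.hyps y S by (simp only: A_finsum_insert) (simp add: A_ring_simps minus_smult smult_add_right)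
  moreover have "cnorm A (complex_of_real (T - 1) \<odot> \<one> \<ominus> ?S) \<le> T - 1"
    using insert y by (intro insert.IH) auto
  ultimately show ?case
    using cnorm_add_le[of "\<one> \<ominus> y j" "complex_of_real (T - 1) \<odot> \<one> \<ominus> ?S" 1 "T - 1"] insert.prems(2)[of j] y S
    by simp
qed

text \<open>The norm bound on \<open>1 - y\<^sub>k\<close> plays the role of positivity of \<open>y\<^sub>k\<close>, without functional calculus.\<close>

lemma positive_sum_zero:
  assumes J: "finite J" and y: "y \<in> J \<rightarrow> carrier A" and le: "\<And>k. k \<in> J \<Longrightarrow> cnorm A (\<one> \<ominus> y k) \<le> 1"
    and sa: "\<And>k. k \<in> J \<Longrightarrow> (y k)\<^sup>\<star> = y k" and sum: "(\<Oplus>k\<in>J. y k) = \<zero>" and k: "k \<in> J"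
  shows "y k = \<zero>"
proof -
  let ?S = "\<Oplus>j\<in>J - {k}. y j" and ?T = "real (card J)"
  have yk: "y k \<in> carrier A" and S: "?S \<in> carrier A" using y k by (auto intro!: A_finsum_closed)
  have T: "?T > 0" using J k by (auto simp: card_gt_0_iff)
  have "y k \<oplus> ?S = (\<Oplus>j\<in>insert k (J - {k}). y j)"
    using J y k by (intro A_finsum_insert[symmetric]) auto
  then have "y k \<oplus> ?S = \<zero>" using sum k by (simp add: insert_absorb)
  then have Sk: "?S = (-1) \<odot> y k"
    using yk S by (metis A_ring_simps(15,18) A_ring_simps(3) uminus_smult)
  \<comment> \<open>Since \<open>?S\<close> is minus \<open>y k\<close>, the estimate for
    \<open>J - {k}\<close> bounds T + y_k, and the one for \<open>{k}\<close> bounds T - y_k.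
    Division by T turns these into the two hypotheses of
    \<open>zero_if_cnorm_one_pm_le_1\<close>.\<close>
  have "cnorm A (complex_of_real ?T \<odot> \<one> \<ominus> ?S) \<le> ?T"
    using J y le by (intro cnorm_shift_sum_le) (auto simp: card_Diff1_le)
  then have 1: "cnorm A (complex_of_real ?T \<odot> \<one> \<oplus> y k) \<le> ?T"
    unfolding Sk using yk by (simp add: minus_smult)
  have "cnorm A (complex_of_real ?T \<odot> \<one> \<ominus> (\<Oplus>j\<in>{k}. y j)) \<le> ?T"
    using T y k le by (intro cnorm_shift_sum_le) auto
  then have 2: "cnorm A (complex_of_real ?T \<odot> \<one> \<ominus> y k) \<le> ?T"
    using yk by (simp add: A_finsum_insert A_finsum_empty A_ring_simps)
  have scale: "cnorm A (complex_of_real (1/?T) \<odot> z) \<le> 1" if "cnorm A z \<le> ?T" "z \<in> carrier A" for z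
    using that T by (simp add: cnorm_smult norm_divide field_simps)
  have "complex_of_real (1/?T) \<odot> y k = \<zero>"
  proof (rule zero_if_cnorm_one_pm_le_1)
    show "cnorm A (\<one> \<oplus> complex_of_real (1/?T) \<odot> y k) \<le> 1"
      using scale[OF 1] yk T by (simp add: smult_add_right)
    show "cnorm A (\<one> \<ominus> complex_of_real (1/?T) \<odot> y k) \<le> 1"
      using scale[OF 2] yk T by (simp add: smult_add_right minus_smult)
  qed (use yk sa k in \<open>simp_all add: star_smult\<close>)
  then have "complex_of_real ?T \<odot> (complex_of_real (1/?T) \<odot> y k) = \<zero>" by (simp only: smult_zero)
  then show ?thesis using yk T by simp
qed

end

subsection \<open>Boundedness of *-homomorphisms\<close>

lemma unital_star_homD:
  assumes "h \<in> unital_star_hom A B"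
  shows "x \<in> carrier A \<Longrightarrow> h x \<in> carrier B"
    and "\<lbrakk>x \<in> carrier A; y \<in> carrier A\<rbrakk> \<Longrightarrow> h (x \<otimes>\<^bsub>A\<^esub> y) = h x \<otimes>\<^bsub>B\<^esub> h y"
    and "\<lbrakk>x \<in> carrier A; y \<in> carrier A\<rbrakk> \<Longrightarrow> h (x \<oplus>\<^bsub>A\<^esub> y) = h x \<oplus>\<^bsub>B\<^esub> h y"
    and "h \<one>\<^bsub>A\<^esub> = \<one>\<^bsub>B\<^esub>"
    and "x \<in> carrier A \<Longrightarrow> h (c \<odot>\<^bsub>A\<^esub> x) = c \<odot>\<^bsub>B\<^esub> h x"
    and "x \<in> carrier A \<Longrightarrow> h (x\<^sup>\<star>\<^bsub>A\<^esub>) = (h x)\<^sup>\<star>\<^bsub>B\<^esub>"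
  using assms by (auto simp: unital_star_hom_def ring_hom_def)

lemma unital_star_hom_zero:
  assumes "unital_cstar_algebra A" "unital_cstar_algebra B" "h \<in> unital_star_hom A B"
  shows "h \<zero>\<^bsub>A\<^esub> = \<zero>\<^bsub>B\<^esub>"
proof -
  interpret A: unital_cstar_algebra A by fact
  interpret B: unital_cstar_algebra B by fact
  show ?thesis
    using unital_star_homD(5)[OF assms(3), of "\<zero>\<^bsub>A\<^esub>" 0] unital_star_homD(1)[OF assms(3), of "\<zero>\<^bsub>A\<^esub>"]
    by (simp add: A.A_ring_simps)
qed

lemma unital_star_hom_minus:
  assumes "unital_cstar_algebra A" "unital_cstar_algebra B" "h \<in> unital_star_hom A B"
    and "x \<in> carrier A" "y \<in> carrier A"
  shows "h (x \<ominus>\<^bsub>A\<^esub> y) = h x \<ominus>\<^bsub>B\<^esub> h y"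
  using assms
  by (simp add: unital_cstar_algebra.minus_smult unital_star_homD unital_cstar_algebra.smult_in_carrier)

text \<open>The constant 2 reflects the radius 1/2 in \<open>sqrt_exists\<close>; continuity is all
  that is wanted. Scaling gives the bound for self-adjoint elements, and the C*-identity extends it
  to \<open>x\<close> through \<open>x\<^sup>\<star> \<otimes> x\<close>.\<close>

lemma unital_star_hom_bounded:
  assumes A: "unital_cstar_algebra A" and B: "unital_cstar_algebra B"
    and h: "h \<in> unital_star_hom A B" and x: "x \<in> carrier A"
  shows "cnorm B (h x) \<le> 2 * cnorm A x"
proof -
  interpret A: unital_cstar_algebra A by fact
  interpret B: unital_cstar_algebra B by fact
  note hD [simp] = unital_star_homD[OF h]
  have small: "cnorm B (h a) \<le> 1"
    if a: "a \<in> carrier A" "a\<^sup>\<star>\<^bsub>A\<^esub> = a" "cnorm A a \<le> 1/2" for a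
  proof -
    obtain b where b: "b \<in> carrier A" "b\<^sup>\<star>\<^bsub>A\<^esub> = b" "a \<otimes>\<^bsub>A\<^esub> b = b \<otimes>\<^bsub>A\<^esub> a"
      "a \<otimes>\<^bsub>A\<^esub> a \<oplus>\<^bsub>A\<^esub> b \<otimes>\<^bsub>A\<^esub> b = \<one>\<^bsub>A\<^esub>"
      using A.sqrt_exists[OF a] by metis
    show ?thesis
    proof (rule B.cnorm_le_1_if_sum_squares[of _ "h b"])
      show "h a \<otimes>\<^bsub>B\<^esub> h a \<oplus>\<^bsub>B\<^esub> h b \<otimes>\<^bsub>B\<^esub> h b = \<one>\<^bsub>B\<^esub>"
        using arg_cong[OF b(4), of h] a b(1) by simp
      show "h a \<otimes>\<^bsub>B\<^esub> h b = h b \<otimes>\<^bsub>B\<^esub> h a"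
        using b a by (metis hD(2))
      show "(h a)\<^sup>\<star>\<^bsub>B\<^esub> = h a" "(h b)\<^sup>\<star>\<^bsub>B\<^esub> = h b"
        using a b by (metis hD(6))+
    qed (use a b in simp_all)
  qed
  have sa: "cnorm B (h a) \<le> 2 * cnorm A a" if a: "a \<in> carrier A" "a\<^sup>\<star>\<^bsub>A\<^esub> = a" for a
  proof (cases "cnorm A a = 0")
    case True
    then show ?thesis
      using a unital_star_hom_zero[OF A B h] by (simp add: A.cnorm_eq_zero)
  next
    case False
    then have pos: "cnorm A a > 0" using a by (simp add: order_less_le)
    define c where "c = complex_of_real (1 / (2 * cnorm A a))"
    have "cnorm B (h (c \<odot>\<^bsub>A\<^esub> a)) \<le> 1"
      using a pos by (intro small) (simp_all add: A.star_smult A.cnorm_smult c_def norm_mult norm_divide)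
    then show ?thesis
      using a pos by (simp add: B.cnorm_smult c_def norm_mult norm_divide field_simps)
  qed
  have "(cnorm B (h x))\<^sup>2 = cnorm B (h (x\<^sup>\<star>\<^bsub>A\<^esub> \<otimes>\<^bsub>A\<^esub> x))"
    using x by (simp add: B.cstar_identity)
  also have "\<dots> \<le> 2 * cnorm A (x\<^sup>\<star>\<^bsub>A\<^esub> \<otimes>\<^bsub>A\<^esub> x)"
    using x by (intro sa) (simp_all add: A.star_mult)
  also have "\<dots> \<le> (2 * cnorm A x)\<^sup>2"
    using x by (simp add: A.cstar_identity power2_eq_square)
  finally show ?thesis using x by - (rule power2_le_imp_le, simp_all)
qed

text \<open>The set where \<open>h\<close> and \<open>g\<close> agree is a *-subalgebra containing
  \<open>G\<close>, and by boundedness of both maps it is closed.\<close>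

lemma unital_star_hom_eqI:
  assumes A: "unital_cstar_algebra A" and B: "unital_cstar_algebra B"
    and h: "h \<in> unital_star_hom A B" and g: "g \<in> unital_star_hom A B"
    and G: "generates_cstar A G" "\<And>x. x \<in> G \<Longrightarrow> h x = g x" and x: "x \<in> carrier A"
  shows "h x = g x"
proof -
  interpret A: unital_cstar_algebra A by fact
  interpret B: unital_cstar_algebra B by fact
  note hD [simp] = unital_star_homD[OF h]
  note gD [simp] = unital_star_homD[OF g]
  let ?S = "{x \<in> carrier A. h x = g x}"
  have "h x = g x"
    if X: "\<forall>k. X k \<in> ?S" and x: "x \<in> carrier A" and lim: "(\<lambda>k. cnorm A (X k \<ominus>\<^bsub>A\<^esub> x)) \<longlonglongrightarrow> 0" for X x
  proof (rule B.eqI_of_cnorm_null[OF _ _ lim])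
    show "h x \<in> carrier B" "g x \<in> carrier B" using x by simp_all
    fix k
    have Xk: "X k \<in> carrier A" "h (X k) = g (X k)" using X by auto
    have "cnorm B (h x \<ominus>\<^bsub>B\<^esub> g x) \<le> cnorm B (h x \<ominus>\<^bsub>B\<^esub> h (X k)) + cnorm B (h (X k) \<ominus>\<^bsub>B\<^esub> g x)"
      using x Xk(1) by (intro B.cnorm_minus_triangle) simp_all
    also have "cnorm B (h x \<ominus>\<^bsub>B\<^esub> h (X k)) = cnorm B (h (X k \<ominus>\<^bsub>A\<^esub> x))"
      using x Xk(1) by (simp add: unital_star_hom_minus[OF A B h] B.cnorm_minus_commute)
    also have "h (X k) \<ominus>\<^bsub>B\<^esub> g x = g (X k \<ominus>\<^bsub>A\<^esub> x)"
      using x Xk by (simp add: unital_star_hom_minus[OF A B g])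
    also have "cnorm B (h (X k \<ominus>\<^bsub>A\<^esub> x)) + cnorm B (g (X k \<ominus>\<^bsub>A\<^esub> x))
        \<le> 2 * cnorm A (X k \<ominus>\<^bsub>A\<^esub> x) + 2 * cnorm A (X k \<ominus>\<^bsub>A\<^esub> x)"
      using x Xk(1) by (intro add_mono unital_star_hom_bounded[OF A B] h g) simp_all
    finally show "cnorm B (h x \<ominus>\<^bsub>B\<^esub> g x) \<le> 4 * cnorm A (X k \<ominus>\<^bsub>A\<^esub> x)" by simp
  qed
  then have "cstar_subalgebra A ?S"
    unfolding cstar_subalgebra_def
    using unital_star_hom_zero[OF A B h] unital_star_hom_zero[OF A B g]
    by (auto simp: A.A_ring_simps)
  with G x show ?thesis unfolding generates_cstar_def by blast
qed

subsection \<open>Isometries with complementary ranges\<close>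

text \<open>The Cuntz relations, over an arbitrary index set so that they cover both kinds of edges.
  That the ranges are mutually orthogonal is derived in \<open>orthogonal\<close>.\<close>

locale cuntz_family = unital_cstar_algebra A for A :: "'a cstar" (structure) +
  fixes I :: "'i set" and a :: "'i \<Rightarrow> 'a"
  assumes fin: "finite I"
    and a_closed [simp]: "i \<in> I \<Longrightarrow> a i \<in> carrier A"
    and isometry: "i \<in> I \<Longrightarrow> (a i)\<^sup>\<star> \<otimes> a i = \<one>"
    and range_sum: "(\<Oplus>i\<in>I. a i \<otimes> (a i)\<^sup>\<star>) = \<one>"
begin

text \<open>Compressing the sum of the range projections by \<open>a i\<close> gives positive
  elements \<open>y j\<close> with sum 1. The term \<open>y i\<close> is already 1, so the others
  sum to zero and vanish one by one; \<open>y k\<close> is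
  \<open>z\<^sup>\<star> \<otimes> z\<close> for
  \<open>z = (a k)\<^sup>\<star> \<otimes> a i\<close>.\<close>

lemma orthogonal:
  assumes i: "i \<in> I" and k: "k \<in> I" and "i \<noteq> k"
  shows "(a k)\<^sup>\<star> \<otimes> a i = \<zero>"
proof -
  define y where "y j = ((a i)\<^sup>\<star> \<otimes> (a j \<otimes> (a j)\<^sup>\<star>)) \<otimes> a i" for j
  have y: "y j \<in> carrier A" if "j \<in> I" for j using i that by (simp add: y_def)
  have "(\<Oplus>j\<in>I. y j) = ((a i)\<^sup>\<star> \<otimes> (\<Oplus>j\<in>I. a j \<otimes> (a j)\<^sup>\<star>)) \<otimes> a i"
    unfolding y_def using i fin by (subst A_finsum_rdistr, simp, simp, simp add: Pi_iff)
      (subst A_finsum_ldistr, auto)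
  also have "\<dots> = \<one>" using i by (simp add: range_sum isometry A_ring_simps)
  finally have sum1: "(\<Oplus>j\<in>I. y j) = \<one>" .
  have "(\<Oplus>j\<in>insert i (I - {i}). y j) = y i \<oplus> (\<Oplus>j\<in>I - {i}. y j)"
    using i y fin by (intro A_finsum_insert) auto
  moreover have "y i = ((a i)\<^sup>\<star> \<otimes> a i) \<otimes> ((a i)\<^sup>\<star> \<otimes> a i)"
    using i by (simp add: y_def A_assoc)
  ultimately have "\<one> \<oplus> (\<Oplus>j\<in>I - {i}. y j) = \<one>"
    using sum1 i by (simp add: isometry insert_absorb A_ring_simps)
  moreover have "(\<Oplus>j\<in>I - {i}. y j) \<in> carrier A" using y by (intro A_finsum_closed) auto
  ultimately have sum0: "(\<Oplus>j\<in>I - {i}. y j) = \<zero>"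
    by (metis A_ring_simps(6) A_ring_simps(9) A_ring_simps(18))
  have "y k = \<zero>"
  proof (rule positive_sum_zero[OF _ _ _ _ sum0])
    \<comment> \<open>\<open>\<one> \<ominus> y j\<close> is the compression by the isometry
      \<open>a i\<close> of the projection complementary to the range of \<open>a j\<close>.\<close>
    show "cnorm A (\<one> \<ominus> y j) \<le> 1" if "j \<in> I - {i}" for j
    proof -
      define p where "p = a j \<otimes> (a j)\<^sup>\<star>"
      from that have j: "j \<in> I" by simp
      have p: "p \<in> carrier A" "p\<^sup>\<star> = p" using j by (simp_all add: p_def star_mult)
      have "p \<otimes> p = a j \<otimes> (((a j)\<^sup>\<star> \<otimes> a j) \<otimes> (a j)\<^sup>\<star>)" using j by (simp add: p_def A_assoc)
      then have pp: "p \<otimes> p = p" using j by (simp add: isometry A_ring_simps p_def)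
      have "(\<one> \<ominus> p)\<^sup>\<star> \<otimes> (\<one> \<ominus> p) = \<one> \<ominus> p"
        using p pp by (simp add: minus_smult star_add star_smult) (simp add: lin_simps)
      then have "cnorm A (\<one> \<ominus> p) \<le> 1" using p by (intro cnorm_projection_le_1) simp_all
      moreover have "\<one> \<ominus> y j = ((a i)\<^sup>\<star> \<otimes> (\<one> \<ominus> p)) \<otimes> a i"
        unfolding y_def p_def[symmetric] using i p by (simp add: lin_simps isometry)
      moreover have "cnorm A (a i) \<le> 1" using i by (simp add: cnorm_isometry_le_1 isometry)
      ultimately show ?thesis
        using i p cnorm_mult_le[of "(a i)\<^sup>\<star> \<otimes> (\<one> \<ominus> p)" "a i" "1 * 1" 1] cnorm_mult_le[of "(a i)\<^sup>\<star>" "\<one> \<ominus> p" 1 1]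
        by simp
    qed
    show "(y j)\<^sup>\<star> = y j" if "j \<in> I - {i}" for j
      using that i by (simp add: y_def star_mult A_assoc)
  qed (use fin y k \<open>i \<noteq> k\<close> in auto)
  moreover have "((a k)\<^sup>\<star> \<otimes> a i)\<^sup>\<star> \<otimes> ((a k)\<^sup>\<star> \<otimes> a i) = y k"
    using i k by (simp add: y_def star_mult A_assoc)
  ultimately have "(cnorm A ((a k)\<^sup>\<star> \<otimes> a i))\<^sup>2 = 0"
    using cstar_identity[of "(a k)\<^sup>\<star> \<otimes> a i"] i k by simp
  then show ?thesis using i k by (simp add: cnorm_eq_zero)
qed

text \<open>Orthogonality removes every term except \<open>k = i\<close>, where the isometry
  relation leaves \<open>b i\<close>.\<close>

lemma star_mult_sum:
  assumes b: "b \<in> I \<rightarrow> carrier A" and i: "i \<in> I"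
  shows "(\<Oplus>k\<in>I. b k \<otimes> (a k)\<^sup>\<star>) \<otimes> a i = b i"
proof -
  have "(\<Oplus>k\<in>I. b k \<otimes> (a k)\<^sup>\<star>) \<otimes> a i = (\<Oplus>k\<in>I. (b k \<otimes> (a k)\<^sup>\<star>) \<otimes> a i)"
    using fin i b by (intro A_finsum_ldistr) auto
  also have "\<dots> = (\<Oplus>k\<in>I. if i = k then b k else \<zero>)"
    using i b by (intro A_finsum_cong) (auto simp: Pi_iff A_assoc orthogonal isometry A_ring_simps(12-15,24,25))
  also have "\<dots> = b i"
    using fin i b by (intro abelian_monoid.finsum_singleton[OF A_abelian_monoid]) auto
  finally show ?thesis .
qed

text \<open>Multiplying on the right by the unit, written as the sum of the
  \<open>a i \<otimes> (a i)\<^sup>\<star>\<close>, recovers an element from its products with the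
  \<open>a i\<close>.\<close>

lemma cancel:
  assumes "x \<in> carrier A" "y \<in> carrier A" "\<And>i. i \<in> I \<Longrightarrow> x \<otimes> a i = y \<otimes> a i"
  shows "x = y"
proof -
  have expand: "z = (\<Oplus>i\<in>I. (z \<otimes> a i) \<otimes> (a i)\<^sup>\<star>)" if z: "z \<in> carrier A" for z
  proof -
    have "z = z \<otimes> (\<Oplus>i\<in>I. a i \<otimes> (a i)\<^sup>\<star>)" using z by (simp add: range_sum A_ring_simps)
    also have "\<dots> = (\<Oplus>i\<in>I. z \<otimes> (a i \<otimes> (a i)\<^sup>\<star>))"
      using z fin by (intro A_finsum_rdistr) auto
    also have "\<dots> = (\<Oplus>i\<in>I. (z \<otimes> a i) \<otimes> (a i)\<^sup>\<star>)"
      using z by (intro A_finsum_cong) (auto simp: A_assoc)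
    finally show ?thesis .
  qed
  have "x = (\<Oplus>i\<in>I. (x \<otimes> a i) \<otimes> (a i)\<^sup>\<star>)" by (rule expand) fact
  also have "\<dots> = (\<Oplus>i\<in>I. (y \<otimes> a i) \<otimes> (a i)\<^sup>\<star>)"
    using assms by (intro A_finsum_cong) auto
  also have "\<dots> = y" using expand[of y] assms by simp
  finally show ?thesis .
qed

text \<open>For the two kinds of edges the sum is \<open>lambda_eps1\<close> or
  \<open>lambda_eps2\<close>; this rule is how both are used later.\<close>

lemma conj_sum_mult:
  assumes "x \<in> carrier A" "i \<in> I"
  shows "(\<Oplus>k\<in>I. a k \<otimes> x \<otimes> (a k)\<^sup>\<star>) \<otimes> a i = a i \<otimes> x"
  using assms by (intro star_mult_sum) auto

lemma conj_sum_closed: "x \<in> carrier A \<Longrightarrow> (\<Oplus>k\<in>I. a k \<otimes> x \<otimes> (a k)\<^sup>\<star>) \<in> carrier A"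
  by (intro A_finsum_closed) auto

lemma cuntz_family_unitary:
  assumes "U \<in> unitaries A" shows "cuntz_family A I (\<lambda>i. U \<otimes> a i)"
proof -
  have U: "U \<in> carrier A" "U\<^sup>\<star> \<otimes> U = \<one>" "U \<otimes> U\<^sup>\<star> = \<one>" using assms by (auto simp: unitaries_def)
  show ?thesis
  proof unfold_locales
    fix i assume i: "i \<in> I"
    show "U \<otimes> a i \<in> carrier A" using U i by simp
    have "(U \<otimes> a i)\<^sup>\<star> \<otimes> (U \<otimes> a i) = ((a i)\<^sup>\<star> \<otimes> (U\<^sup>\<star> \<otimes> U)) \<otimes> a i"
      using U(1) i by (simp add: star_mult A_assoc)
    then show "(U \<otimes> a i)\<^sup>\<star> \<otimes> (U \<otimes> a i) = \<one>" using U i by (simp add: isometry A_ring_simps)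
  next
    have "(\<Oplus>i\<in>I. (U \<otimes> a i) \<otimes> (U \<otimes> a i)\<^sup>\<star>) = (\<Oplus>i\<in>I. (U \<otimes> (a i \<otimes> (a i)\<^sup>\<star>)) \<otimes> U\<^sup>\<star>)"
      using U(1) by (intro A_finsum_cong) (auto simp: star_mult A_assoc)
    also have "\<dots> = (U \<otimes> (\<Oplus>i\<in>I. a i \<otimes> (a i)\<^sup>\<star>)) \<otimes> U\<^sup>\<star>"
      using U(1) fin by (subst A_finsum_rdistr, simp, simp, simp add: Pi_iff)
        (subst A_finsum_ldistr, auto)
    also have "\<dots> = \<one>" using U by (simp add: range_sum A_ring_simps)
    finally show "(\<Oplus>i\<in>I. (U \<otimes> a i) \<otimes> (U \<otimes> a i)\<^sup>\<star>) = \<one>" .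
  qed (rule fin)
qed

lemma cuntz_family_hom:
  assumes h: "h \<in> unital_star_hom A A" shows "cuntz_family A I (\<lambda>i. h (a i))"
proof unfold_locales
  note hD [simp] = unital_star_homD[OF h]
  fix i assume i: "i \<in> I"
  show "h (a i) \<in> carrier A" using i by simp
  show "(h (a i))\<^sup>\<star> \<otimes> h (a i) = \<one>" using i arg_cong[OF isometry[OF i], of h] by simp
next
  note hD [simp] = unital_star_homD[OF h]
  have *: "h (\<Oplus>i\<in>J. f i) = (\<Oplus>i\<in>J. h (f i))" if "finite J" "f \<in> J \<rightarrow> carrier A" for J and f :: "'i \<Rightarrow> 'a"
    using that
  proof (induction J rule: finite_induct)
    case empty
    show ?case using unital_star_hom_zero[OF _ _ h] unital_cstar_algebra_axioms by (simp add: A_finsum_empty)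
  next
    case (insert j J)
    then show ?case by (simp add: A_finsum_insert A_finsum_closed Pi_iff)
  qed
  have "(\<Oplus>i\<in>I. h (a i) \<otimes> (h (a i))\<^sup>\<star>) = (\<Oplus>i\<in>I. h (a i \<otimes> (a i)\<^sup>\<star>))"
    by (intro A_finsum_cong) auto
  also have "\<dots> = h (\<Oplus>i\<in>I. a i \<otimes> (a i)\<^sup>\<star>)" using fin by (intro *[symmetric]) auto
  finally show "(\<Oplus>i\<in>I. h (a i) \<otimes> (h (a i))\<^sup>\<star>) = \<one>" by (simp add: range_sum)
qed (rule fin)

text \<open>The adjoint of W = \<Sum> b_k a_k^* is the same sum with the two families exchanged, so
  it sends \<open>b i\<close> back to \<open>a i\<close>. Cancelling each family then gives both
  unitarity equations.\<close>

lemma intertwining_unitary: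
  assumes "cuntz_family A I b"
  obtains W where "W \<in> unitaries A" "\<And>i. i \<in> I \<Longrightarrow> W \<otimes> a i = b i"
proof -
  interpret b: cuntz_family A I b by fact
  define W where "W = (\<Oplus>k\<in>I. b k \<otimes> (a k)\<^sup>\<star>)"
  have W: "W \<in> carrier A" unfolding W_def by (intro A_finsum_closed) auto
  have Wa: "W \<otimes> a i = b i" if "i \<in> I" for i
    unfolding W_def using that by (intro star_mult_sum) auto
  have "W\<^sup>\<star> = (\<Oplus>k\<in>I. a k \<otimes> (b k)\<^sup>\<star>)"
    unfolding W_def using fin by (subst star_finsum) (auto simp: star_mult intro!: A_finsum_cong)
  then have Wb: "W\<^sup>\<star> \<otimes> b i = a i" if "i \<in> I" for i
    using that by (simp add: b.star_mult_sum)
  have "W\<^sup>\<star> \<otimes> W = \<one>"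
    by (rule cancel) (use W Wa Wb in \<open>auto simp: A_assoc A_ring_simps(12)\<close>)
  moreover have "W \<otimes> W\<^sup>\<star> = \<one>"
    by (rule b.cancel) (use W Wa Wb in \<open>auto simp: A_assoc A_ring_simps(12)\<close>)
  ultimately have "W \<in> unitaries A"
    using W by (simp add: unitaries_def)
  with Wa show thesis using that by blast
qed

end

subsection \<open>Families indexed by the 2-graph\<close>

definition word_eval :: "('a, 'b) monoid_scheme \<Rightarrow> (edge \<Rightarrow> 'a) \<Rightarrow> edge list \<Rightarrow> 'a" where
  "word_eval A g w = foldr (\<lambda>x y. g x \<otimes>\<^bsub>A\<^esub> y) w \<one>\<^bsub>A\<^esub>"

lemma word_eval_simps [simp]:
  "word_eval A g [] = \<one>\<^bsub>A\<^esub>" "word_eval A g (x # w) = g x \<otimes>\<^bsub>A\<^esub> word_eval A g w"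
  by (simp_all add: word_eval_def)

lemma word_class_closed: "w \<in> words m n \<Longrightarrow> word_rel m n \<theta> `` {w} \<in> carrier (F_theta m n \<theta>)"
  by (simp add: F_theta_def quotientI)

lemma F_theta_carrierE:
  assumes "X \<in> carrier (F_theta m n \<theta>)"
  obtains w where "w \<in> words m n" "X = word_rel m n \<theta> `` {w}"
  using assms by (auto simp: F_theta_def elim: quotientE)

lemma words_simps [simp]:
  "[] \<in> words m n" "E i # w \<in> words m n \<longleftrightarrow> i \<in> {1..m} \<and> w \<in> words m n"
  "F j # w \<in> words m n \<longleftrightarrow> j \<in> {1..n} \<and> w \<in> words m n"
  by (auto simp: words_def)

lemma words_append: "\<lbrakk>u \<in> words m n; v \<in> words m n\<rbrakk> \<Longrightarrow> u @ v \<in> words m n"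
  by (simp add: words_def)

lemma words_induct [consumes 1, case_names Nil E F]:
  assumes "w \<in> words m n" "P []"
    and "\<And>i w. \<lbrakk>i \<in> {1..m}; w \<in> words m n; P w\<rbrakk> \<Longrightarrow> P (E i # w)"
    and "\<And>j w. \<lbrakk>j \<in> {1..n}; w \<in> words m n; P w\<rbrakk> \<Longrightarrow> P (F j # w)"
  shows "P w"
  using assms(1)
proof (induction w)
  case (Cons x w)
  then show ?case using assms(3,4) by (cases x) auto
qed (rule assms(2))

text \<open>The relations of the algebra stated on single edges only. The premises of
  \<open>commute\<close> are those of the generating rule of \<open>word_cong\<close>.\<close>

locale edge_family = unital_cstar_algebra A for A :: "'a cstar" (structure) +
  fixes m n :: nat and \<theta> :: "nat \<times> nat \<Rightarrow> nat \<times> nat" and g :: "edge \<Rightarrow> 'a"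
  assumes family_E: "cuntz_family A {1..m} (\<lambda>i. g (E i))"
    and family_F: "cuntz_family A {1..n} (\<lambda>j. g (F j))"
    and commute: "\<lbrakk>i \<in> {1..m}; j \<in> {1..n}; \<theta> (i, j) = (i', j'); i' \<in> {1..m}; j' \<in> {1..n}\<rbrakk>
      \<Longrightarrow> g (E i) \<otimes> g (F j) = g (F j') \<otimes> g (E i')"
begin

sublocale E: cuntz_family A "{1..m}" "\<lambda>i. g (E i)" by (rule family_E)

sublocale F: cuntz_family A "{1..n}" "\<lambda>j. g (F j)" by (rule family_F)

lemma g_closed [simp]:
  "i \<in> {1..m} \<Longrightarrow> g (E i) \<in> carrier A" "j \<in> {1..n} \<Longrightarrow> g (F j) \<in> carrier A"
  by (rule E.a_closed, simp) (rule F.a_closed, simp)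

lemma word_eval_closed [simp]: "w \<in> words m n \<Longrightarrow> word_eval A g w \<in> carrier A"
  by (induction w rule: words_induct) (simp_all del: atLeastAtMost_iff)

lemma word_eval_append:
  "\<lbrakk>u \<in> words m n; v \<in> words m n\<rbrakk> \<Longrightarrow> word_eval A g (u @ v) = word_eval A g u \<otimes> word_eval A g v"
  by (induction u rule: words_induct) (simp_all add: A_assoc A_ring_simps(12) del: atLeastAtMost_iff)

lemma word_eval_cong: "word_cong m n \<theta> u v \<Longrightarrow> word_eval A g u = word_eval A g v"
proof (induction rule: word_cong.induct)
  case (commute u v i j i' j')
  have "word_eval A g ([E i, F j] @ v) = word_eval A g ([F j', E i'] @ v)"
    using commute edge_family.commute[OF edge_family_axioms commute(3-7)]
    by (simp del: atLeastAtMost_iff flip: A_assoc)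
  moreover have "[E i, F j] @ v \<in> words m n" "[F j', E i'] @ v \<in> words m n"
    using commute by simp_all
  ultimately show ?case using commute(1) by (simp only: word_eval_append)
qed auto

lemma word_eval_isometry: "w \<in> words m n \<Longrightarrow> (word_eval A g w)\<^sup>\<star> \<otimes> word_eval A g w = \<one>"
proof (induction w rule: words_induct)
  case (E i w)
  have "(word_eval A g (E i # w))\<^sup>\<star> \<otimes> word_eval A g (E i # w) =
      (word_eval A g w)\<^sup>\<star> \<otimes> (((g (E i))\<^sup>\<star> \<otimes> g (E i)) \<otimes> word_eval A g w)"
    using E by (simp add: star_mult A_assoc del: atLeastAtMost_iff)
  then show ?case using E E.isometry[of i] by (simp add: A_ring_simps del: atLeastAtMost_iff)
next
  case (F j w)
  have "(word_eval A g (F j # w))\<^sup>\<star> \<otimes> word_eval A g (F j # w) =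
      (word_eval A g w)\<^sup>\<star> \<otimes> (((g (F j))\<^sup>\<star> \<otimes> g (F j)) \<otimes> word_eval A g w)"
    using F by (simp add: star_mult A_assoc del: atLeastAtMost_iff)
  then show ?case using F F.isometry[of j] by (simp add: A_ring_simps del: atLeastAtMost_iff)
qed (simp add: A_ring_simps)

text \<open>A class is sent to the value of a chosen representative word;
  \<open>word_eval_cong\<close> makes the choice irrelevant.\<close>

lemma theta_family_exists:
  obtains t where "theta_family m n \<theta> A t" "\<And>i. i \<in> {1..m} \<Longrightarrow> t (edge_e m n \<theta> i) = g (E i)"
    "\<And>j. j \<in> {1..n} \<Longrightarrow> t (edge_f m n \<theta> j) = g (F j)"
proof -
  define t where "t X = word_eval A g (SOME w. w \<in> X)" for X
  have t: "t (word_rel m n \<theta> `` {w}) = word_eval A g w" if "w \<in> words m n" for w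
  proof -
    have "w \<in> word_rel m n \<theta> `` {w}" by (rule equiv_class_self[OF equiv_word_rel that])
    then have "(SOME v. v \<in> word_rel m n \<theta> `` {w}) \<in> word_rel m n \<theta> `` {w}" by (rule someI)
    then show ?thesis by (simp add: t_def word_rel_def word_eval_cong)
  qed
  have te: "t (edge_e m n \<theta> i) = g (E i)" if "i \<in> {1..m}" for i
    using that by (simp add: edge_e_def t A_ring_simps del: atLeastAtMost_iff)
  have tf: "t (edge_f m n \<theta> j) = g (F j)" if "j \<in> {1..n}" for j
    using that by (simp add: edge_f_def t A_ring_simps del: atLeastAtMost_iff)
  have "(\<Oplus>i\<in>{1..m}. t (edge_e m n \<theta> i) \<otimes> (t (edge_e m n \<theta> i))\<^sup>\<star>) = (\<Oplus>i\<in>{1..m}. g (E i) \<otimes> (g (E i))\<^sup>\<star>)"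
    by (intro A_finsum_cong) (auto simp: te)
  moreover have "(\<Oplus>j\<in>{1..n}. t (edge_f m n \<theta> j) \<otimes> (t (edge_f m n \<theta> j))\<^sup>\<star>) = (\<Oplus>j\<in>{1..n}. g (F j) \<otimes> (g (F j))\<^sup>\<star>)"
    by (intro A_finsum_cong) (auto simp: tf)
  moreover have "t (X \<otimes>\<^bsub>F_theta m n \<theta>\<^esub> Y) = t X \<otimes> t Y"
    if "X \<in> carrier (F_theta m n \<theta>)" "Y \<in> carrier (F_theta m n \<theta>)" for X Y
    using that by (elim F_theta_carrierE) (simp add: F_theta_mult t words_append word_eval_append)
  moreover have "t \<one>\<^bsub>F_theta m n \<theta>\<^esub> = \<one>" using t[of "[]"] by (simp add: F_theta_def)
  moreover have "t X \<in> carrier A" "(t X)\<^sup>\<star> \<otimes> t X = \<one>" if "X \<in> carrier (F_theta m n \<theta>)" for X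
    using that by (auto elim!: F_theta_carrierE simp: t word_eval_isometry)
  ultimately have "theta_family m n \<theta> A t"
    unfolding theta_family_def using E.range_sum F.range_sum by simp
  then show thesis using that te tf by blast
qed

end

section \<open>The monoid of unital endomorphisms\<close>

context unital_cstar_algebra
begin

lemma compose_unital_star_hom:
  "\<lbrakk>h \<in> unital_star_hom A A; k \<in> unital_star_hom A A\<rbrakk> \<Longrightarrow> compose (carrier A) h k \<in> unital_star_hom A A"
  by (auto simp: unital_star_hom_def ring_hom_def compose_def Pi_iff)

lemma restrict_unital_star_hom:
  "h \<in> unital_star_hom A A \<Longrightarrow> restrict h (carrier A) \<in> unital_star_hom A A"
  by (auto simp: unital_star_hom_def ring_hom_def)

lemma monoid_End: "monoid (End_monoid A)"
proof (rule monoidI)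
  have "(\<lambda>x. x) \<in> unital_star_hom A A" by (simp add: unital_star_hom_def ring_hom_def)
  then show "\<one>\<^bsub>End_monoid A\<^esub> \<in> carrier (End_monoid A)"
    using restrict_unital_star_hom by (simp add: End_monoid_def)
  fix x y assume "x \<in> carrier (End_monoid A)" "y \<in> carrier (End_monoid A)"
  then show "x \<otimes>\<^bsub>End_monoid A\<^esub> y \<in> carrier (End_monoid A)"
    using compose_unital_star_hom by (auto simp: End_monoid_def compose_def)
next
  fix x y z
  assume xyz: "x \<in> carrier (End_monoid A)" "y \<in> carrier (End_monoid A)" "z \<in> carrier (End_monoid A)"
  \<comment> \<open>\<open>compose\<close> is \<open>undefined\<close> off the carrier, so the two
    bracketings agree only because \<open>z\<close> maps the carrier into itself.\<close>
  then have "z \<in> carrier A \<rightarrow> carrier A" by (auto simp: End_monoid_def dest: unital_star_homD(1))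
  then show "x \<otimes>\<^bsub>End_monoid A\<^esub> y \<otimes>\<^bsub>End_monoid A\<^esub> z = x \<otimes>\<^bsub>End_monoid A\<^esub> (y \<otimes>\<^bsub>End_monoid A\<^esub> z)"
    by (auto simp: End_monoid_def compose_def Pi_iff fun_eq_iff)
next
  fix x assume "x \<in> carrier (End_monoid A)"
  then have "x \<in> carrier A \<rightarrow> carrier A" "x \<in> extensional (carrier A)"
    by (auto simp: End_monoid_def dest: unital_star_homD(1))
  then show "\<one>\<^bsub>End_monoid A\<^esub> \<otimes>\<^bsub>End_monoid A\<^esub> x = x" "x \<otimes>\<^bsub>End_monoid A\<^esub> \<one>\<^bsub>End_monoid A\<^esub> = x"
    by (simp_all add: End_monoid_def Id_compose compose_Id)
qed

end

subsection \<open>Twisted pairs and endomorphisms\<close>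

locale O_theta = unital_cstar_algebra A for A :: "'a cstar" (structure) +
  fixes m n :: nat and \<theta> :: "nat \<times> nat \<Rightarrow> nat \<times> nat" and s :: "edge list set \<Rightarrow> 'a"
  assumes theta_permutes: "\<theta> permutes {1..m} \<times> {1..n}" and O_theta: "is_O_theta m n \<theta> A s"
begin

definition gen :: "edge \<Rightarrow> 'a" where
  "gen x = (case x of E i \<Rightarrow> s (edge_e m n \<theta> i) | F j \<Rightarrow> s (edge_f m n \<theta> j))"

lemma gen_simps: "gen (E i) = s (edge_e m n \<theta> i)" "gen (F j) = s (edge_f m n \<theta> j)"
  by (simp_all add: gen_def)

lemma family: "theta_family m n \<theta> A s"
  using O_theta by (simp add: is_O_theta_def)

lemma edge_closed:
  "i \<in> {1..m} \<Longrightarrow> edge_e m n \<theta> i \<in> carrier (F_theta m n \<theta>)"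
  "j \<in> {1..n} \<Longrightarrow> edge_f m n \<theta> j \<in> carrier (F_theta m n \<theta>)"
  unfolding edge_e_def edge_f_def by (simp_all add: word_class_closed)

lemma s_mult: "\<lbrakk>u \<in> carrier (F_theta m n \<theta>); v \<in> carrier (F_theta m n \<theta>)\<rbrakk>
    \<Longrightarrow> s (u \<otimes>\<^bsub>F_theta m n \<theta>\<^esub> v) = s u \<otimes> s v"
  using family by (simp add: theta_family_def)

sublocale edge_family A m n \<theta> gen
proof unfold_locales
  show "gen (E i) \<otimes> gen (F j) = gen (F j') \<otimes> gen (E i')"
    if "i \<in> {1..m}" "j \<in> {1..n}" "\<theta> (i, j) = (i', j')" "i' \<in> {1..m}" "j' \<in> {1..n}" for i j i' j'
    using edge_commute[OF theta_permutes that(1-3)] that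
    by (simp only: gen_simps edge_closed flip: s_mult)
qed (use family edge_closed in \<open>auto simp: gen_simps theta_family_def Pi_iff\<close>)

lemma s_word: "w \<in> words m n \<Longrightarrow> s (word_rel m n \<theta> `` {w}) = word_eval A gen w"
proof (induction w rule: words_induct)
  case Nil
  then show ?case using family by (simp add: theta_family_def F_theta_def)
next
  case (E i w)
  have "word_rel m n \<theta> `` {E i # w} = edge_e m n \<theta> i \<otimes>\<^bsub>F_theta m n \<theta>\<^esub> word_rel m n \<theta> `` {w}"
    unfolding edge_e_def using E by (subst F_theta_mult) auto
  then show ?case using E s_mult[OF edge_closed(1)[OF E(1)] word_class_closed[OF E(2)]]
    by (simp add: gen_simps)
next
  case (F j w)
  have "word_rel m n \<theta> `` {F j # w} = edge_f m n \<theta> j \<otimes>\<^bsub>F_theta m n \<theta>\<^esub> word_rel m n \<theta> `` {w}"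
    unfolding edge_f_def using F by (subst F_theta_mult) auto
  then show ?case using F s_mult[OF edge_closed(2)[OF F(1)] word_class_closed[OF F(2)]]
    by (simp add: gen_simps)
qed

text \<open>Agreement passes from edges to words, then to the generated C*-algebra by boundedness,
  and extensionality makes it equality of functions.\<close>

lemma End_eqI:
  assumes h: "h \<in> carrier (End_monoid A)" and k: "k \<in> carrier (End_monoid A)"
    and e: "\<And>i. i \<in> {1..m} \<Longrightarrow> h (gen (E i)) = k (gen (E i))"
    and f: "\<And>j. j \<in> {1..n} \<Longrightarrow> h (gen (F j)) = k (gen (F j))"
  shows "h = k"
proof -
  have hom: "h \<in> unital_star_hom A A" "k \<in> unital_star_hom A A"
    and ext: "h \<in> extensional (carrier A)" "k \<in> extensional (carrier A)"
    using h k by (auto simp: End_monoid_def)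
  note hD = unital_star_homD[OF hom(1)] and kD = unital_star_homD[OF hom(2)]
  have word: "h (word_eval A gen w) = k (word_eval A gen w)" if "w \<in> words m n" for w
    using that by (induction w rule: words_induct) (simp_all add: hD kD e f del: atLeastAtMost_iff)
  have gens: "generates_cstar A (s ` carrier (F_theta m n \<theta>))"
    using O_theta by (simp add: is_O_theta_def)
  have "h x = k x" if "x \<in> s ` carrier (F_theta m n \<theta>)" for x
    using that by (auto elim!: F_theta_carrierE simp: s_word word)
  then have "h x = k x" if "x \<in> carrier A" for x
    using unital_star_hom_eqI[OF _ _ hom gens] that unital_cstar_algebra_axioms by blast
  then show ?thesis using ext by (auto intro: extensionalityI)
qed

text \<open>The universal property is applied with \<open>A\<close> itself as target. The map it
  yields is arbitrary off the carrier and has to be restricted.\<close>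

lemma End_exists:
  assumes "edge_family A m n \<theta> g"
  obtains h where "h \<in> carrier (End_monoid A)" "\<And>i. i \<in> {1..m} \<Longrightarrow> h (gen (E i)) = g (E i)"
    "\<And>j. j \<in> {1..n} \<Longrightarrow> h (gen (F j)) = g (F j)"
proof -
  interpret g: edge_family A m n \<theta> g by fact
  obtain t where t: "theta_family m n \<theta> A t" "\<And>i. i \<in> {1..m} \<Longrightarrow> t (edge_e m n \<theta> i) = g (E i)"
    "\<And>j. j \<in> {1..n} \<Longrightarrow> t (edge_f m n \<theta> j) = g (F j)"
    using g.theta_family_exists by blast
  obtain h where h: "h \<in> unital_star_hom A A" "\<And>u. u \<in> carrier (F_theta m n \<theta>) \<Longrightarrow> h (s u) = t u"
    using O_theta t(1) unital_cstar_algebra_axioms unfolding is_O_theta_def by blast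
  have "restrict h (carrier A) \<in> carrier (End_monoid A)"
    using restrict_unital_star_hom[OF h(1)] by (simp add: End_monoid_def)
  moreover have "restrict h (carrier A) (gen (E i)) = g (E i)" if "i \<in> {1..m}" for i
    using that g_closed(1)[OF that] h(2)[OF edge_closed(1)[OF that]] t(2)[OF that] by (simp add: gen_simps)
  moreover have "restrict h (carrier A) (gen (F j)) = g (F j)" if "j \<in> {1..n}" for j
    using that g_closed(2)[OF that] h(2)[OF edge_closed(2)[OF that]] t(3)[OF that] by (simp add: gen_simps)
  ultimately show thesis using that by blast
qed

section \<open>The twist equation as a commutation relation\<close>

abbreviation "\<Lambda> \<equiv> lambda_end m n \<theta> A s"

abbreviation "twisted \<equiv> twisted_pairs m n \<theta> A s"

lemma lambda_eps1: "x \<in> carrier A \<Longrightarrow> lambda_eps1 m n \<theta> A s x \<in> carrier A"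
  "\<lbrakk>x \<in> carrier A; i \<in> {1..m}\<rbrakk> \<Longrightarrow> lambda_eps1 m n \<theta> A s x \<otimes> gen (E i) = gen (E i) \<otimes> x"
  using E.conj_sum_mult[of x i] E.conj_sum_closed[of x] by (simp_all add: lambda_eps1_def gen_simps)

lemma lambda_eps2: "x \<in> carrier A \<Longrightarrow> lambda_eps2 m n \<theta> A s x \<in> carrier A"
  "\<lbrakk>x \<in> carrier A; j \<in> {1..n}\<rbrakk> \<Longrightarrow> lambda_eps2 m n \<theta> A s x \<otimes> gen (F j) = gen (F j) \<otimes> x"
  using F.conj_sum_mult[of x j] F.conj_sum_closed[of x] by (simp_all add: lambda_eps2_def gen_simps)

lemma twistedD:
  assumes "(U, V) \<in> twisted"
  shows "U \<in> unitaries A" "V \<in> unitaries A" "U \<in> carrier A" "V \<in> carrier A"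
    "U \<otimes> lambda_eps1 m n \<theta> A s V = V \<otimes> lambda_eps2 m n \<theta> A s U"
  using assms by (auto simp: twisted_pairs_def unitaries_def)

lemma theta_in:
  assumes "i \<in> {1..m}" "j \<in> {1..n}" "\<theta> (i, j) = (i', j')"
  shows "i' \<in> {1..m}" "j' \<in> {1..n}"
  using permutes_in_image[OF theta_permutes, of "(i, j)"] assms by auto

text \<open>\<open>lambda_eps1\<close> passes V across s_e directly. For \<open>lambda_eps2\<close>
  the product s_e s_f is first rewritten as s_f' s_e', so that U can be passed across s_f'.\<close>

lemma twist_sides:
  assumes UV: "U \<in> carrier A" "V \<in> carrier A"
    and ij: "i \<in> {1..m}" "j \<in> {1..n}" "\<theta> (i, j) = (i', j')"
  shows "((U \<otimes> lambda_eps1 m n \<theta> A s V) \<otimes> gen (E i)) \<otimes> gen (F j) = (U \<otimes> gen (E i)) \<otimes> (V \<otimes> gen (F j))"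
    and "((V \<otimes> lambda_eps2 m n \<theta> A s U) \<otimes> gen (E i)) \<otimes> gen (F j) = (V \<otimes> gen (F j')) \<otimes> (U \<otimes> gen (E i'))"
proof -
  note ij' = theta_in[OF ij]
  note g = g_closed(1)[OF ij(1)] g_closed(2)[OF ij(2)] g_closed(1)[OF ij'(1)] g_closed(2)[OF ij'(2)]
  note l = lambda_eps1(1)[OF UV(2)] lambda_eps2(1)[OF UV(1)]
  have "((U \<otimes> lambda_eps1 m n \<theta> A s V) \<otimes> gen (E i)) \<otimes> gen (F j)
      = (U \<otimes> (lambda_eps1 m n \<theta> A s V \<otimes> gen (E i))) \<otimes> gen (F j)"
    using UV g l by (simp add: A_assoc)
  then show "((U \<otimes> lambda_eps1 m n \<theta> A s V) \<otimes> gen (E i)) \<otimes> gen (F j) = (U \<otimes> gen (E i)) \<otimes> (V \<otimes> gen (F j))"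
    unfolding lambda_eps1(2)[OF UV(2) ij(1)] using UV g by (simp add: A_assoc)
  have "((V \<otimes> lambda_eps2 m n \<theta> A s U) \<otimes> gen (E i)) \<otimes> gen (F j)
      = (V \<otimes> lambda_eps2 m n \<theta> A s U) \<otimes> (gen (F j') \<otimes> gen (E i'))"
    unfolding commute[OF ij ij', symmetric] using UV g l by (simp add: A_assoc)
  also have "\<dots> = (V \<otimes> (lambda_eps2 m n \<theta> A s U \<otimes> gen (F j'))) \<otimes> gen (E i')"
    using UV g l by (simp add: A_assoc)
  finally show "((V \<otimes> lambda_eps2 m n \<theta> A s U) \<otimes> gen (E i)) \<otimes> gen (F j) = (V \<otimes> gen (F j')) \<otimes> (U \<otimes> gen (E i'))"
    unfolding lambda_eps2(2)[OF UV(1) ij'(2)] using UV g by (simp add: A_assoc)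
qed

lemma twisted_edge_family:
  assumes UV: "(U, V) \<in> twisted"
  shows "edge_family A m n \<theta> (case_edge (\<lambda>i. U \<otimes> gen (E i)) (\<lambda>j. V \<otimes> gen (F j)))"
proof (intro edge_family.intro edge_family_axioms.intro)
  show "cuntz_family A {1..m} (\<lambda>i. case_edge (\<lambda>i. U \<otimes> gen (E i)) (\<lambda>j. V \<otimes> gen (F j)) (E i))"
    using E.cuntz_family_unitary[OF twistedD(1)[OF UV]] by simp
  show "cuntz_family A {1..n} (\<lambda>j. case_edge (\<lambda>i. U \<otimes> gen (E i)) (\<lambda>j. V \<otimes> gen (F j)) (F j))"
    using F.cuntz_family_unitary[OF twistedD(2)[OF UV]] by simp
  fix i j i' j' assume ij: "i \<in> {1..m}" "j \<in> {1..n}" "\<theta> (i, j) = (i', j')"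
  show "case_edge (\<lambda>i. U \<otimes> gen (E i)) (\<lambda>j. V \<otimes> gen (F j)) (E i) \<otimes> case_edge (\<lambda>i. U \<otimes> gen (E i)) (\<lambda>j. V \<otimes> gen (F j)) (F j)
    = case_edge (\<lambda>i. U \<otimes> gen (E i)) (\<lambda>j. V \<otimes> gen (F j)) (F j') \<otimes> case_edge (\<lambda>i. U \<otimes> gen (E i)) (\<lambda>j. V \<otimes> gen (F j)) (E i')"
    using twist_sides[OF twistedD(3,4)[OF UV] ij] twistedD(5)[OF UV] by simp
qed (rule unital_cstar_algebra_axioms)

text \<open>\<open>End_exists\<close> and \<open>End_eqI\<close> supply the existence and uniqueness
  that the definite description needs.\<close>

lemma lambda_end:
  assumes "(U, V) \<in> twisted"
  shows "\<Lambda> (U, V) \<in> carrier (End_monoid A)"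
    and "\<And>i. i \<in> {1..m} \<Longrightarrow> \<Lambda> (U, V) (gen (E i)) = U \<otimes> gen (E i)"
    and "\<And>j. j \<in> {1..n} \<Longrightarrow> \<Lambda> (U, V) (gen (F j)) = V \<otimes> gen (F j)"
proof -
  let ?P = "\<lambda>\<phi>. \<phi> \<in> carrier (End_monoid A) \<and> (\<forall>i\<in>{1..m}. \<phi> (gen (E i)) = U \<otimes> gen (E i)) \<and>
    (\<forall>j\<in>{1..n}. \<phi> (gen (F j)) = V \<otimes> gen (F j))"
  obtain h where "h \<in> carrier (End_monoid A)"
    "\<And>i. i \<in> {1..m} \<Longrightarrow> h (gen (E i)) = case_edge (\<lambda>i. U \<otimes> gen (E i)) (\<lambda>j. V \<otimes> gen (F j)) (E i)"
    "\<And>j. j \<in> {1..n} \<Longrightarrow> h (gen (F j)) = case_edge (\<lambda>i. U \<otimes> gen (E i)) (\<lambda>j. V \<otimes> gen (F j)) (F j)"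
    using End_exists[OF twisted_edge_family[OF assms]] by blast
  then have "?P h" by simp
  then have "\<exists>!\<phi>. ?P \<phi>" by (intro ex1I[of _ h]) (auto intro!: End_eqI)
  then have "?P (THE \<phi>. ?P \<phi>)" by (rule theI')
  moreover have "\<Lambda> (U, V) = (THE \<phi>. ?P \<phi>)" by (simp only: lambda_end_def gen_simps prod.case)
  ultimately have "?P (\<Lambda> (U, V))" by simp
  then show "\<Lambda> (U, V) \<in> carrier (End_monoid A)"
    "\<And>i. i \<in> {1..m} \<Longrightarrow> \<Lambda> (U, V) (gen (E i)) = U \<otimes> gen (E i)"
    "\<And>j. j \<in> {1..n} \<Longrightarrow> \<Lambda> (U, V) (gen (F j)) = V \<otimes> gen (F j)" by auto
qed

section \<open>Bijectivity of the correspondence\<close>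

lemma lambda_end_eqI:
  assumes UV: "(U, V) \<in> twisted" and h: "h \<in> carrier (End_monoid A)"
    and "\<And>i. i \<in> {1..m} \<Longrightarrow> h (gen (E i)) = U \<otimes> gen (E i)"
    and "\<And>j. j \<in> {1..n} \<Longrightarrow> h (gen (F j)) = V \<otimes> gen (F j)"
  shows "\<Lambda> (U, V) = h"
  using assms lambda_end[OF UV] by (intro End_eqI) auto

lemma lambda_end_surj:
  assumes h: "h \<in> carrier (End_monoid A)"
  obtains U V where "(U, V) \<in> twisted" "\<Lambda> (U, V) = h"
proof -
  have hom: "h \<in> unital_star_hom A A" using h by (simp add: End_monoid_def)
  note hD = unital_star_homD[OF hom]
  obtain U where U: "U \<in> unitaries A" "\<And>i. i \<in> {1..m} \<Longrightarrow> U \<otimes> gen (E i) = h (gen (E i))"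
    using E.intertwining_unitary[OF E.cuntz_family_hom[OF hom]] by blast
  obtain V where V: "V \<in> unitaries A" "\<And>j. j \<in> {1..n} \<Longrightarrow> V \<otimes> gen (F j) = h (gen (F j))"
    using F.intertwining_unitary[OF F.cuntz_family_hom[OF hom]] by blast
  have UV: "U \<in> carrier A" "V \<in> carrier A" using U V by (auto simp: unitaries_def)
  let ?L = "U \<otimes> lambda_eps1 m n \<theta> A s V" and ?R = "V \<otimes> lambda_eps2 m n \<theta> A s U"
  have LR: "?L \<in> carrier A" "?R \<in> carrier A" using UV lambda_eps1(1) lambda_eps2(1) by simp_all
  \<comment> \<open>Cancelling s_e and then s_f reduces the twist equation to equality of the values
    of \<open>h\<close> at s_e s_f and at s_f' s_e'.\<close>
  have "?L = ?R"
  proof (rule E.cancel[OF LR], rule F.cancel)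
    fix i j assume i: "i \<in> {1..m}" and j: "j \<in> {1..n}"
    obtain i' j' where \<theta>: "\<theta> (i, j) = (i', j')" by (cases "\<theta> (i, j)")
    note ij' = theta_in[OF i j \<theta>]
    show "(?L \<otimes> gen (E i)) \<otimes> gen (F j) = (?R \<otimes> gen (E i)) \<otimes> gen (F j)"
      unfolding twist_sides[OF UV i j \<theta>] U(2)[OF i] V(2)[OF j] U(2)[OF ij'(1)] V(2)[OF ij'(2)]
      using commute[OF i j \<theta> ij'] i j ij' by (simp del: atLeastAtMost_iff flip: hD(2))
  qed (use LR in \<open>auto simp del: atLeastAtMost_iff\<close>)
  then have tw: "(U, V) \<in> twisted" using U V by (simp add: twisted_pairs_def)
  moreover have "\<Lambda> (U, V) = h" using U V by (intro lambda_end_eqI[OF tw h]) auto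
  ultimately show thesis using that by blast
qed

lemma lambda_end_inj: "inj_on \<Lambda> twisted"
proof (rule inj_onI, clarify)
  fix U V U' V' assume UV: "(U, V) \<in> twisted" "(U', V') \<in> twisted" and eq: "\<Lambda> (U, V) = \<Lambda> (U', V')"
  have "U = U'"
    by (rule E.cancel) (use twistedD[OF UV(1)] twistedD[OF UV(2)] lambda_end(2)[OF UV(1)] lambda_end(2)[OF UV(2)] eq in auto)
  moreover have "V = V'"
    by (rule F.cancel) (use twistedD[OF UV(1)] twistedD[OF UV(2)] lambda_end(3)[OF UV(1)] lambda_end(3)[OF UV(2)] eq in auto)
  ultimately show "U = U' \<and> V = V'" by simp
qed

text \<open>The twist equation for the product is not computed: the composite is an endomorphism, so
  it comes from some twisted pair. On generators the composite sends s_e to \<Lambda>_2(U_1 s_e) =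
  \<Lambda>_2(U_1) U_2 s_e, and similarly for s_f, which identifies that pair by
  cancellation.\<close>

lemma lambda_end_mult:
  assumes p: "(U1, V1) \<in> twisted" and q: "(U2, V2) \<in> twisted"
  shows "(\<Lambda> (U2, V2) U1 \<otimes> U2, \<Lambda> (U2, V2) V1 \<otimes> V2) \<in> twisted"
    and "\<Lambda> (\<Lambda> (U2, V2) U1 \<otimes> U2, \<Lambda> (U2, V2) V1 \<otimes> V2) = \<Lambda> (U2, V2) \<otimes>\<^bsub>End_monoid A\<^esub> \<Lambda> (U1, V1)"
proof -
  interpret Mon: Group.monoid "End_monoid A" by (rule monoid_End)
  let ?h = "\<Lambda> (U2, V2) \<otimes>\<^bsub>End_monoid A\<^esub> \<Lambda> (U1, V1)"
  have "?h \<in> carrier (End_monoid A)" using lambda_end(1)[OF p] lambda_end(1)[OF q] by (rule Mon.m_closed[rotated])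
  then obtain U V where UV: "(U, V) \<in> twisted" "\<Lambda> (U, V) = ?h" by (rule lambda_end_surj)
  have hom: "\<Lambda> (U2, V2) \<in> unital_star_hom A A" using lambda_end(1)[OF q] by (simp add: End_monoid_def)
  note hD = unital_star_homD[OF hom]
  note P = twistedD[OF p] and Q = twistedD[OF q]
  have "U \<otimes> gen (E i) = (\<Lambda> (U2, V2) U1 \<otimes> U2) \<otimes> gen (E i)" if "i \<in> {1..m}" for i
    using lambda_end(2)[OF UV(1) that] lambda_end(2)[OF p that] lambda_end(2)[OF q that] g_closed(1)[OF that] P Q
    unfolding UV(2) by (simp add: End_monoid_def compose_def hD A_assoc)
  then have U: "U = \<Lambda> (U2, V2) U1 \<otimes> U2"
    using twistedD(3)[OF UV(1)] P Q by - (rule E.cancel, simp_all add: hD)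
  have "V \<otimes> gen (F j) = (\<Lambda> (U2, V2) V1 \<otimes> V2) \<otimes> gen (F j)" if "j \<in> {1..n}" for j
    using lambda_end(3)[OF UV(1) that] lambda_end(3)[OF p that] lambda_end(3)[OF q that] g_closed(2)[OF that] P Q
    unfolding UV(2) by (simp add: End_monoid_def compose_def hD A_assoc)
  then have V: "V = \<Lambda> (U2, V2) V1 \<otimes> V2"
    using twistedD(4)[OF UV(1)] P Q by - (rule F.cancel, simp_all add: hD)
  show "(\<Lambda> (U2, V2) U1 \<otimes> U2, \<Lambda> (U2, V2) V1 \<otimes> V2) \<in> twisted"
    "\<Lambda> (\<Lambda> (U2, V2) U1 \<otimes> U2, \<Lambda> (U2, V2) V1 \<otimes> V2) = ?h"
    using UV unfolding U V by simp_all
qed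

text \<open>Same method as for products: the pair representing the identity fixes every generator
  under left multiplication, so both entries are the unit.\<close>

lemma lambda_end_one: "(\<one>, \<one>) \<in> twisted" "\<Lambda> (\<one>, \<one>) = \<one>\<^bsub>End_monoid A\<^esub>"
proof -
  interpret Mon: Group.monoid "End_monoid A" by (rule monoid_End)
  obtain U V where UV: "(U, V) \<in> twisted" "\<Lambda> (U, V) = \<one>\<^bsub>End_monoid A\<^esub>"
    using Mon.one_closed by (rule lambda_end_surj)
  have "U \<otimes> gen (E i) = \<one> \<otimes> gen (E i)" if "i \<in> {1..m}" for i
    using lambda_end(2)[OF UV(1) that] g_closed(1)[OF that] unfolding UV(2)
    by (simp add: End_monoid_def A_ring_simps(12))
  then have U: "U = \<one>" using twistedD(3)[OF UV(1)] by - (rule E.cancel, simp_all)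
  have "V \<otimes> gen (F j) = \<one> \<otimes> gen (F j)" if "j \<in> {1..n}" for j
    using lambda_end(3)[OF UV(1) that] g_closed(2)[OF that] unfolding UV(2)
    by (simp add: End_monoid_def A_ring_simps(12))
  then have V: "V = \<one>" using twistedD(4)[OF UV(1)] by - (rule F.cancel, simp_all)
  show "(\<one>, \<one>) \<in> twisted" "\<Lambda> (\<one>, \<one>) = \<one>\<^bsub>End_monoid A\<^esub>" using UV by (simp_all add: U V)
qed

end

lemma monoid_transport:
  assumes H: "monoid H" and inj: "inj_on h (carrier G)" and hom: "h \<in> hom G H"
    and closed: "\<And>x y. \<lbrakk>x \<in> carrier G; y \<in> carrier G\<rbrakk> \<Longrightarrow> x \<otimes>\<^bsub>G\<^esub> y \<in> carrier G"
    and one: "\<one>\<^bsub>G\<^esub> \<in> carrier G" "h \<one>\<^bsub>G\<^esub> = \<one>\<^bsub>H\<^esub>"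
  shows "monoid G"
proof -
  interpret H: monoid H by fact
  have h: "h (x \<otimes>\<^bsub>G\<^esub> y) = h x \<otimes>\<^bsub>H\<^esub> h y" "h x \<in> carrier H"
    if "x \<in> carrier G" "y \<in> carrier G" for x y
    using hom that by (auto simp: hom_def)
  show ?thesis
    by (rule monoidI) (auto intro!: inj_onD[OF inj] simp: closed one h H.m_assoc)
qed

theorem corollary3p7:
  fixes m n :: nat
    and \<theta> :: "nat \<times> nat \<Rightarrow> nat \<times> nat"
    and A :: "'a cstar"
    and s :: "edge list set \<Rightarrow> 'a"
  assumes "1 \<le> m" and "1 \<le> n"
    and "\<theta> permutes {1..m} \<times> {1..n}"
    and "is_O_theta m n \<theta> A s"
  shows "monoid (twisted_monoid m n \<theta> A s) \<and>
         lambda_end m n \<theta> A s \<in> iso (twisted_monoid m n \<theta> A s) (End_monoid A) \<and>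
         lambda_end m n \<theta> A s \<one>\<^bsub>twisted_monoid m n \<theta> A s\<^esub> = \<one>\<^bsub>End_monoid A\<^esub>"
proof -
  have "unital_cstar_algebra A" using assms(4) by (simp add: is_O_theta_def)
  then interpret O_theta A m n \<theta> s
    using assms(3,4) by (intro O_theta.intro O_theta_axioms.intro)
  let ?T = "twisted_monoid m n \<theta> A s"
  have car: "carrier ?T = twisted" and one: "\<one>\<^bsub>?T\<^esub> = (\<one>\<^bsub>A\<^esub>, \<one>\<^bsub>A\<^esub>)"
    and mult: "(U2, V2) \<otimes>\<^bsub>?T\<^esub> (U1, V1) = (\<Lambda> (U2, V2) U1 \<otimes>\<^bsub>A\<^esub> U2, \<Lambda> (U2, V2) V1 \<otimes>\<^bsub>A\<^esub> V2)"
    for U1 V1 U2 V2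
    by (simp_all add: twisted_monoid_def)
  have closed: "x \<otimes>\<^bsub>?T\<^esub> y \<in> carrier ?T" if "x \<in> carrier ?T" "y \<in> carrier ?T" for x y
    using that lambda_end_mult(1) by (cases x; cases y) (simp add: car mult)
  have hom: "\<Lambda> \<in> hom ?T (End_monoid A)"
    using lambda_end(1) lambda_end_mult(2) by (auto simp: hom_def car mult)
  have "bij_betw \<Lambda> (carrier ?T) (carrier (End_monoid A))"
    unfolding bij_betw_def car
  proof (intro conjI equalityI subsetI lambda_end_inj)
    show "h \<in> carrier (End_monoid A)" if "h \<in> \<Lambda> ` twisted" for h
      using that lambda_end(1) by auto
    show "h \<in> \<Lambda> ` twisted" if "h \<in> carrier (End_monoid A)" for h
      using that by (elim lambda_end_surj) auto
  qed
  with hom have "\<Lambda> \<in> iso ?T (End_monoid A)" by (simp add: iso_def)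
  \<comment> \<open>Associativity and the unit laws on pairs are those of composition, read back
    through \<open>\<Lambda>\<close>.\<close>
  moreover have "monoid ?T"
    using lambda_end_inj lambda_end_one closed hom
    by (intro monoid_transport[OF monoid_End, of \<Lambda>]) (simp_all add: car one)
  ultimately show ?thesis by (simp add: one lambda_end_one)
qed

end
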